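(* Let $\psi:\mathbb{R}^n\to\mathbb{R}$, $\phi_1:\mathbb{R}^n\to\mathbb{R}$ and $\phi_2:\mathbb{R}^n\to\mathbb{R}\cup\{+\infty\}$ be functions such that: (1) $\psi$ is differentiable and $\nabla\psi$ is $\beta$-Lipschitz; (2) $\phi_1$ is $l_\phi$-weakly convex with $l_\phi\in[0,1)$, and moreover $\phi_1$ is differentiable with $L_\phi$-Lipschitz gradient; (3) $\phi_2$ is proper and closed, and $\operatorname{prox}_{\phi_2}(q)$ is nonempty for every $q\in\mathbb{R}^n$. Let $\gamma>0$ and $\eta\in(0,1]$ be such that $\Lambda(\gamma,\eta)>0$, where $$\Lambda(\gamma,\eta)=\frac1\gamma\left[-\frac{1+l_\phi}{2}+\frac{1-L_\phi^2}{\eta}\right]-\beta\left[1+\frac{(1-\eta+L_\phi)^2}{2\eta^2}\right].$$ Let $\{(x^k,u^k,w^k)\}_{k\ge0}$ be a sequence in $(\mathbb{R}^n)^3$ (with arbitrary initial values $x^0,u^0,w^0$) satisfying, for all $k\ge0$, $$x^{k+1}=\operatorname{prox}_{\phi_1}(w^k),\qquad u^{k+1}\in\operatorname{prox}_{\phi_2}\big(2x^{k+1}-w^k-\gamma\nabla\psi(x^{k+1})\big),\qquad w^{k+1}=w^k+\eta(u^{k+1}-x^{k+1}).$$ Assume further that the sequence $\{(x^k,u^k,w^k)\}_{k\ge0}$ is bounded and that the function $$\Theta_{\gamma,\eta}(x,u,w)=\psi(x)+\frac1\gamma\phi_1(x)+\frac1\gamma\phi_2(u)+\frac{1}{2\gamma}\|2x-u-w-\gamma\nabla\psi(x)\|^2-\frac{1}{2\gamma}\|w-x+\gamma\nabla\psi(x)\|^2-\frac{\eta}{\gamma}\|x-u\|^2$$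 on $(\mathbb{R}^n)^3$ is a Kurdyka–Łojasiewicz function. Then the sequence has finite length, i.e. $$\sum_{k=0}^\infty\|x^{k+1}-x^k\|<+\infty,\qquad\sum_{k=0}^\infty\|u^{k+1}-u^k\|<+\infty,\qquad\sum_{k=0}^\infty\|w^{k+1}-w^k\|<+\infty.$$ In particular, the sequences $(x^k)$ and $(u^k)$ converge to a (common) critical point of $F=\psi+\gamma^{-1}\phi_1+\gamma^{-1}\phi_2$, i.e. to a point $x^\star$ with $0\in\partial F(x^\star)$.
   Context: $\|\cdot\|$ is the Euclidean norm. For $\phi:\mathbb{R}^n\to\mathbb{R}\cup\{+\infty\}$, $\operatorname{prox}_\phi(q)=\operatorname{argmin}_{v\in\mathbb{R}^n}\{\phi(v)+\frac12\|v-q\|^2\}$, in general a set of minimizers. A function $\phi$ is $l$-weakly convex if $\phi+\frac{l}{2}\|\cdot\|^2$ is convex; for $l<1$ and $\phi$ real-valued and $l$-weakly convex, $\operatorname{prox}_\phi$ is single-valued. A function is closed if it is lower semicontinuous. $\partial$ denotes the limiting (Mordukhovich) subdifferential, and $\operatorname{dist}(0,S)=\inf_{v\in S}\|v\|$ (equal to $+\infty$ if $S=\emptyset$). Kurdyka–Łojasiewicz (KL) property: a proper closed function $f$ satisfies the KL property at $x^\star\in\operatorname{dom}\partial f$ if there exist a neighborhood $V$ of $x^\star$, $\delta\in(0,\infty)$ and a continuous concave function $\Psi:[0,\delta)\to\mathbb{R}_+$ with $\Psi(0)=0$ such that (i) $\Psi$ is continuous on $[0,\delta)$ and continuously differentiable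 on $(0,\delta)$ with $\Psi'>0$; (ii) for all $x\in V$ with $f(x^\star)<f(x)<f(x^\star)+\delta$, one has $\Psi'(f(x)-f(x^\star))\operatorname{dist}(0,\partial f(x))\ge1$. A proper closed function satisfying the KL property at all points of $\operatorname{dom}\partial f$ is called a KL function. *)

theory Defs
  imports "HOL-Analysis.Analysis"
begin

text \<open>
  Functions with values in the reals extended by \<open>+\<infinity>\<close> are functions into \<^typ>\<open>ereal\<close>; that
  \<open>-\<infinity>\<close> is not attained is part of \<open>proper_fun\<close>.
\<close>

definition proper_fun :: "('a \<Rightarrow> ereal) \<Rightarrow> bool" where
  "proper_fun f \<longleftrightarrow> (\<forall>x. f x \<noteq> -\<infinity>) \<and> (\<exists>x. f x \<noteq> \<infinity>)"

definition closed_fun :: "('a::topological_space \<Rightarrow> ereal) \<Rightarrow> bool" where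
  "closed_fun f \<longleftrightarrow> (\<forall>x. f x \<le> Liminf (at x) f)"

definition weakly_convex :: "real \<Rightarrow> ('a::real_normed_vector \<Rightarrow> real) \<Rightarrow> bool" where
  "weakly_convex l f \<longleftrightarrow> convex_on UNIV (\<lambda>x. f x + l / 2 * (norm x)\<^sup>2)"

text \<open>Only meaningful where \<open>f\<close> is differentiable.\<close>

definition grad :: "('a::real_inner \<Rightarrow> real) \<Rightarrow> 'a \<Rightarrow> 'a" where
  "grad f x = (THE D. GDERIV f x :> D)"

definition prox :: "('a::real_normed_vector \<Rightarrow> ereal) \<Rightarrow> 'a \<Rightarrow> 'a set" where
  "prox f q = {v. is_arg_min (\<lambda>v. f v + ereal (1 / 2 * (norm (v - q))\<^sup>2)) (\<lambda>_. True) v}"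

text \<open>The regular (Frechet) subdifferential; it is empty at points where \<open>f\<close> is not finite.\<close>

definition regular_subdiff :: "('a::real_inner \<Rightarrow> ereal) \<Rightarrow> 'a \<Rightarrow> 'a set" where
  "regular_subdiff f x =
    {v. \<bar>f x\<bar> \<noteq> \<infinity> \<and>
        0 \<le> Liminf (at x) (\<lambda>y. (f y - f x - ereal (v \<bullet> (y - x))) / ereal (norm (y - x)))}"

text \<open>
  The limiting (Mordukhovich) subdifferential: limits of regular subgradients along sequences
  converging to \<open>x\<close> together with their function values.
\<close>

definition limiting_subdiff :: "('a::real_inner \<Rightarrow> ereal) \<Rightarrow> 'a \<Rightarrow> 'a set" where
  "limiting_subdiff f x =
    {v. \<bar>f x\<bar> \<noteq> \<infinity> \<and>
        (\<exists>xs vs. xs \<longlonglongrightarrow> x \<and> (\<lambda>k. f (xs k)) \<longlonglongrightarrow> f x \<and>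
                 (\<forall>k. vs k \<in> regular_subdiff f (xs k)) \<and> vs \<longlonglongrightarrow> v)}"

definition dist_zero :: "'a::real_normed_vector set \<Rightarrow> ereal" where
  "dist_zero S = (INF v\<in>S. ereal (norm v))"

definition KL_property_at :: "('a::real_inner \<Rightarrow> ereal) \<Rightarrow> 'a \<Rightarrow> bool" where
  "KL_property_at f xs \<longleftrightarrow>
    (\<exists>V \<delta> \<Psi> \<Psi>'. xs \<in> interior V \<and> 0 < (\<delta>::real) \<and>
       (\<forall>t\<in>{0..<\<delta>}. 0 \<le> \<Psi> t) \<and> \<Psi> 0 = 0 \<and> concave_on {0..<\<delta>} \<Psi> \<and> continuous_on {0..<\<delta>} \<Psi> \<and>
       (\<forall>t\<in>{0<..<\<delta>}. (\<Psi> has_real_derivative \<Psi>' t) (at t) \<and> 0 < \<Psi>' t) \<and>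
       continuous_on {0<..<\<delta>} \<Psi>' \<and>
       (\<forall>x\<in>V. f xs < f x \<and> f x < f xs + ereal \<delta> \<longrightarrow>
          1 \<le> ereal (\<Psi>' (real_of_ereal (f x - f xs))) * dist_zero (limiting_subdiff f x)))"

definition KL_function :: "('a::real_inner \<Rightarrow> ereal) \<Rightarrow> bool" where
  "KL_function f \<longleftrightarrow> proper_fun f \<and> closed_fun f \<and>
    (\<forall>x. limiting_subdiff f x \<noteq> {} \<longrightarrow> KL_property_at f x)"

definition Lambda :: "real \<Rightarrow> real \<Rightarrow> real \<Rightarrow> real \<Rightarrow> real \<Rightarrow> real" where
  "Lambda \<beta> l L \<gamma> \<eta> =
    1 / \<gamma> * (- (1 + l) / 2 + (1 - L\<^sup>2) / \<eta>) - \<beta> * (1 + (1 - \<eta> + L)\<^sup>2 / (2 * \<eta>\<^sup>2))"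

definition Theta ::
  "('a::real_inner \<Rightarrow> real) \<Rightarrow> ('a \<Rightarrow> real) \<Rightarrow> ('a \<Rightarrow> ereal) \<Rightarrow> real \<Rightarrow> real \<Rightarrow> 'a \<times> 'a \<times> 'a \<Rightarrow> ereal"
where
  "Theta \<psi> \<phi>1 \<phi>2 \<gamma> \<eta> = (\<lambda>(x, u, w).
     ereal (\<psi> x) + ereal (1 / \<gamma> * \<phi>1 x) + ereal (1 / \<gamma>) * \<phi>2 u
     + ereal (1 / (2 * \<gamma>) * (norm (2 *\<^sub>R x - u - w - \<gamma> *\<^sub>R grad \<psi> x))\<^sup>2)
     - ereal (1 / (2 * \<gamma>) * (norm (w - x + \<gamma> *\<^sub>R grad \<psi> x))\<^sup>2)
     - ereal (\<eta> / \<gamma> * (norm (x - u))\<^sup>2))"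

end

theory Submission
  imports Defs
begin

text \<open>
  Write \<open>d k = \<parallel>x (k+1) - x k\<parallel>\<close> for \<open>k \<ge> 1\<close>. Optimality of the three steps gives
  \<open>\<Theta> (z (k+1)) \<le> \<Theta> (z k) - \<Lambda> (d k)\<^sup>2\<close>. Since \<open>w (k-1) = x k + \<nabla>\<phi>1 (x k)\<close>, both \<open>w k - w (k-1)\<close> and
  \<open>x k - u k\<close> are bounded by multiples of \<open>d k\<close>, and so is the slope of \<open>\<Theta>\<close> at \<open>z k\<close>. The sufficient
  decrease and the slope carry the same index, so the KL inequality at a cluster point turns into
  \<open>a d k \<le> \<Psi> (\<Theta> (z k) - \<Theta>*) - \<Psi> (\<Theta> (z (k+1)) - \<Theta>*)\<close>, which telescopes.

  As \<open>\<psi>\<close> is not twice differentiable, \<open>\<Theta>\<close> is not smooth in \<open>x\<close> and may have no regular subgradient at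
  \<open>z k\<close>. Minimizing \<open>x \<mapsto> \<Theta> (x, u k, w k) + c \<parallel>x - x k\<parallel>\<^sup>2\<close> over a small ball yields small regular
  subgradients at points arbitrarily close to \<open>z k\<close>, and that suffices.
\<close>

section \<open>Gradients, proximal points and subgradients\<close>

text \<open>The penalized minimization by itself gives no bound on the subgradients it produces: the
  penalty coefficient grows as the ball shrinks. The bound comes from the shape of
  \<open>Theta\<close>. In its expansion the squares of
  \<open>x - w - \<gamma> grad \<psi> x\<close> cancel, so \<open>grad \<psi>\<close> survives only
  linearly, paired with \<open>x - u\<close>. Hence every slope of the x-part differs from an
  explicit vector by at most \<beta> times the norm of \<open>x - u\<close>, which is again of the
  order of the step.

  The nonconvex \<phi>2 enters only through the minimality inequality of its proximal points and
  through lower semicontinuity. Subgradients are handled throughout as explicit quadratic minorants: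
  these add up over the summands, so no sum rule for limiting subdifferentials is invoked.\<close>

lemma gderiv_grad:
  fixes f :: "'a::euclidean_space \<Rightarrow> real"
  assumes "f differentiable (at x)"
  shows "GDERIV f x :> grad f x"
proof -
  obtain f' where f': "(f has_derivative f') (at x)"
    using assms by (auto simp: differentiable_def)
  have lin: "linear f'" using f' by (simp add: has_derivative_bounded_linear bounded_linear.linear)
  have "f' h = h \<bullet> adjoint f' 1" for h
    using adjoint_works[OF lin, of h 1] by simp
  then have "f' = (\<lambda>h. h \<bullet> adjoint f' 1)" by (rule ext)
  then have ex: "GDERIV f x :> adjoint f' 1" using f' by (simp add: gderiv_def)
  show ?thesis unfolding grad_def
  proof (rule theI)
    show "GDERIV f x :> adjoint f' 1" by (fact ex)
    fix D assume "GDERIV f x :> D"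
    then have "(\<lambda>h. h \<bullet> D) = (\<lambda>h. h \<bullet> adjoint f' 1)"
      using ex unfolding gderiv_def by (rule has_derivative_unique)
    then have "\<forall>h. h \<bullet> D = h \<bullet> adjoint f' 1" by (rule fun_cong[THEN allI])
    then show "D = adjoint f' 1" by (simp only: vector_eq_ldot)
  qed
qed

text \<open>The descent lemma, proved by monotonicity along the segment instead of integration:
  subtracting the linear and quadratic terms leaves a function \<open>g\<close> on [0,1] whose
  derivative is nonpositive by the Lipschitz bound.\<close>

lemma lipschitz_gradient_upper_bound:
  fixes f :: "'a::real_inner \<Rightarrow> real"
  assumes G: "\<And>p. GDERIV f p :> G p" and lip: "B-lipschitz_on UNIV G"
  shows "f y \<le> f x + G x \<bullet> (y - x) + B / 2 * (norm (y - x))\<^sup>2"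
proof -
  define d where "d = y - x"
  define g where "g t = f (x + t *\<^sub>R d) - t * (G x \<bullet> d) - B / 2 * t\<^sup>2 * (norm d)\<^sup>2" for t
  have "g 1 \<le> g 0"
  proof (rule DERIV_nonpos_imp_nonincreasing[of 0 1 g])
    fix t :: real assume t: "0 \<le> t" "t \<le> 1"
    have "((\<lambda>t. f (x + t *\<^sub>R d)) has_derivative (\<lambda>h. (h *\<^sub>R d) \<bullet> G (x + t *\<^sub>R d))) (at t)"
      by (rule has_derivative_compose[of "\<lambda>t. x + t *\<^sub>R d" _ _ UNIV f, simplified])
        (use G[of "x + t *\<^sub>R d"] in \<open>auto simp: gderiv_def intro!: derivative_eq_intros\<close>)
    then have "((\<lambda>t. f (x + t *\<^sub>R d)) has_real_derivative (G (x + t *\<^sub>R d) \<bullet> d)) (at t)"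
      by (simp add: has_field_derivative_def inner_commute mult.commute[of _ "G (x + t *\<^sub>R d) \<bullet> d"]
          mult_commute_abs)
    then have "(g has_real_derivative (G (x + t *\<^sub>R d) \<bullet> d - G x \<bullet> d - B * t * (norm d)\<^sup>2)) (at t)"
      unfolding g_def by (auto intro!: derivative_eq_intros)
    moreover have "(G (x + t *\<^sub>R d) - G x) \<bullet> d \<le> (B * (t * norm d)) * norm d"
    proof -
      have "norm (G (x + t *\<^sub>R d) - G x) \<le> B * (t * norm d)"
        using lipschitz_onD[OF lip, of "x + t *\<^sub>R d" x] t by (simp add: dist_norm)
      then show ?thesis
        by (meson norm_cauchy_schwarz order_trans mult_right_mono norm_ge_zero)
    qed
    ultimately show "\<exists>z. (g has_real_derivative z) (at t) \<and> z \<le> 0"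
      by (intro exI conjI) (auto simp: inner_diff_left power2_eq_square mult.assoc)
  qed simp
  then show ?thesis by (simp add: g_def d_def)
qed

text \<open>The one-sided bound is applied to both \<open>f\<close> and its negative.\<close>

lemma lipschitz_gradient_bounds:
  fixes f :: "'a::euclidean_space \<Rightarrow> real"
  assumes f: "\<forall>p. f differentiable (at p)" and lip: "B-lipschitz_on UNIV (grad f)"
  shows "\<bar>f y - f x - grad f x \<bullet> (y - x)\<bar> \<le> B / 2 * (norm (y - x))\<^sup>2"
proof -
  have G: "GDERIV f p :> grad f p" for p
    using f by (simp add: gderiv_grad)
  have "- f y \<le> - f x + (- grad f x) \<bullet> (y - x) + B / 2 * (norm (y - x))\<^sup>2"
  proof (rule lipschitz_gradient_upper_bound)
    show "GDERIV (\<lambda>p. - f p) p :> - grad f p" for p by (rule GDERIV_minus[OF G])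
    show "B-lipschitz_on UNIV (\<lambda>p. - grad f p)" using lip by simp
  qed
  with lipschitz_gradient_upper_bound[OF G lip, of y x] show ?thesis
    unfolding inner_minus_left by linarith
qed

text \<open>Both sides are tested in the direction \<open>\<xi> - s\<close>; dividing by the
  displacement and letting it tend to 0 removes the quadratic terms, whatever their constants. With
  \<kappa> = 0 this identifies a proximal subgradient with the gradient; a positive \<kappa>
  accommodates a Lipschitz perturbation of a smooth function.\<close>

lemma subgradient_near_gradient:
  fixes x :: "'a::real_inner"
  assumes "0 < \<rho>" "0 \<le> \<kappa>"
    and le: "\<And>y. norm (y - x) < \<rho> \<Longrightarrow>
      \<xi> \<bullet> (y - x) - c * (norm (y - x))\<^sup>2 \<le> s \<bullet> (y - x) + \<kappa> * norm (y - x) + C * (norm (y - x))\<^sup>2"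
  shows "norm (\<xi> - s) \<le> \<kappa>"
proof (cases "\<xi> = s")
  case False
  define e where "e = \<xi> - s"
  have e: "0 < norm e" using False by (simp add: e_def)
  have "eventually (\<lambda>t. norm e \<le> \<kappa> + (c + C) * t * norm e) (at_right 0)"
    unfolding eventually_at_right_field
  proof (intro exI[of _ "\<rho> / norm e"] conjI allI impI)
    show "0 < \<rho> / norm e" using e \<open>0 < \<rho>\<close> by simp
    fix t assume t: "0 < t" "t < \<rho> / norm e"
    have "t * norm e < \<rho>" using t(2) e by (simp add: pos_less_divide_eq)
    with t le[of "x + t *\<^sub>R e"] have "t * (\<xi> \<bullet> e) - c * (t * norm e)\<^sup>2 \<le> t * (s \<bullet> e) + \<kappa> * (t * norm e) + C * (t * norm e)\<^sup>2"
      by simp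
    moreover have "\<xi> \<bullet> e - s \<bullet> e = (norm e)\<^sup>2"
      by (simp add: e_def power2_norm_eq_inner inner_diff_left)
    then have "t * (\<xi> \<bullet> e) - t * (s \<bullet> e) = t * (norm e)\<^sup>2"
      by (metis right_diff_distrib)
    ultimately have "(t * norm e) * norm e \<le> (t * norm e) * (\<kappa> + (c + C) * t * norm e)"
      by (simp add: power2_eq_square algebra_simps)
    then show "norm e \<le> \<kappa> + (c + C) * t * norm e"
      using t e by (simp add: mult_le_cancel_left_pos)
  qed
  moreover have "((\<lambda>t. \<kappa> + (c + C) * t * norm e) \<longlongrightarrow> \<kappa> + (c + C) * 0 * norm e) (at_right 0)"
    by (intro tendsto_intros)
  ultimately have "norm e \<le> \<kappa> + (c + C) * 0 * norm e"
    by (intro tendsto_lowerbound) auto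
  then show ?thesis by (simp add: e_def)
qed (use \<open>0 \<le> \<kappa>\<close> in simp)

text \<open>Density of proximal subgradients for a continuous function: an interior minimizer of
  \<open>h\<close> plus a quadratic penalty has the negative gradient of the penalty as a proximal
  subgradient.\<close>

lemma proximal_subgradient_nearby:
  fixes h :: "'a::euclidean_space \<Rightarrow> real"
  assumes cont: "continuous_on UNIV h" and "0 < \<epsilon>"
  obtains p c \<rho> \<xi> where "norm (p - x) < \<epsilon>" "0 < \<rho>"
    "\<And>y. norm (y - p) < \<rho> \<Longrightarrow> h p + \<xi> \<bullet> (y - p) - c * (norm (y - p))\<^sup>2 \<le> h y"
proof -
  have ne: "cball x \<epsilon> \<noteq> {}" using \<open>0 < \<epsilon>\<close> by simp
  obtain m where m: "\<And>y. y \<in> cball x \<epsilon> \<Longrightarrow> h m \<le> h y"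
    using continuous_attains_inf[OF compact_cball ne continuous_on_subset[OF cont subset_UNIV]] by blast
  \<comment> \<open>On the sphere the penalty equals \<open>h x - h m + 1\<close>, so every value
    there exceeds the value \<open>h x\<close> at the centre and the minimizer is interior.\<close>
  define c where "c = (h x - h m + 1) / \<epsilon>\<^sup>2"
  have "continuous_on (cball x \<epsilon>) (\<lambda>y. h y + c * (norm (y - x))\<^sup>2)"
    using continuous_on_subset[OF cont subset_UNIV] by (intro continuous_intros) auto
  then obtain p where p: "p \<in> cball x \<epsilon>"
    and min: "\<And>y. y \<in> cball x \<epsilon> \<Longrightarrow> h p + c * (norm (p - x))\<^sup>2 \<le> h y + c * (norm (y - x))\<^sup>2"
    using continuous_attains_inf[OF compact_cball ne] by blast
  have "norm (p - x) \<noteq> \<epsilon>"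
  proof
    assume "norm (p - x) = \<epsilon>"
    with min[of x] m[OF p] \<open>0 < \<epsilon>\<close> show False by (simp add: c_def)
  qed
  with p have px: "norm (p - x) < \<epsilon>" by (simp add: dist_norm norm_minus_commute)
  show ?thesis
  proof
    show "norm (p - x) < \<epsilon>" by (fact px)
    show "0 < \<epsilon> - norm (p - x)" using px by simp
    fix y assume "norm (y - p) < \<epsilon> - norm (p - x)"
    then have "y \<in> cball x \<epsilon>"
      using norm_triangle_ineq[of "y - p" "p - x"] by (simp add: dist_norm norm_minus_commute)
    from min[OF this] have "h p + c * ((norm (p - x))\<^sup>2 - (norm (y - x))\<^sup>2) \<le> h y"
      by (simp add: algebra_simps)
    moreover have "(norm (p - x))\<^sup>2 - (norm (y - x))\<^sup>2
        = (- 2 *\<^sub>R (p - x)) \<bullet> (y - p) - (norm (y - p))\<^sup>2"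
      by (simp add: power2_norm_eq_inner inner_diff_left inner_diff_right inner_commute algebra_simps)
    then have "c * ((norm (p - x))\<^sup>2 - (norm (y - x))\<^sup>2)
        = (c *\<^sub>R (- 2 *\<^sub>R (p - x))) \<bullet> (y - p) - c * (norm (y - p))\<^sup>2"
      by (simp only: right_diff_distrib inner_scaleR_left)
    ultimately show "h p + (c *\<^sub>R (- 2 *\<^sub>R (p - x))) \<bullet> (y - p) - c * (norm (y - p))\<^sup>2 \<le> h y"
      by linarith
  qed
qed

text \<open>Under a local quadratic minorant the difference quotient is at least
  \<open>- C * norm (y - x)\<close>, which tends to 0.\<close>

lemma regular_subdiffI:
  fixes x :: "'a::real_inner"
  assumes fin: "\<bar>f x\<bar> \<noteq> \<infinity>" and "0 < \<rho>"
    and le: "\<And>y. norm (y - x) < \<rho> \<Longrightarrow> f x + ereal (v \<bullet> (y - x) - C * (norm (y - x))\<^sup>2) \<le> f y"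
  shows "v \<in> regular_subdiff f x"
proof -
  obtain r where r: "f x = ereal r" using fin by (cases "f x") auto
  have "0 \<le> Liminf (at x) (\<lambda>y. (f y - f x - ereal (v \<bullet> (y - x))) / ereal (norm (y - x)))"
    unfolding le_Liminf_iff
  proof (intro allI impI)
    fix e :: ereal assume "e < 0"
    then obtain a where a: "e < ereal a" "a < 0"
      using ereal_dense2[of e 0] by auto
    define D where "D = min \<rho> (- a / (\<bar>C\<bar> + 1))"
    have D: "0 < D" using a \<open>0 < \<rho>\<close> by (simp add: D_def divide_neg_pos)
    show "\<forall>\<^sub>F y in at x. e < (f y - f x - ereal (v \<bullet> (y - x))) / ereal (norm (y - x))"
      unfolding eventually_at
    proof (intro exI[of _ D] conjI ballI impI D)
      fix y assume "y \<noteq> x \<and> dist y x < D"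
      then have y: "0 < norm (y - x)" "norm (y - x) < \<rho>" and small: "norm (y - x) < - a / (\<bar>C\<bar> + 1)"
        by (auto simp: dist_norm D_def)
      have "C * norm (y - x) \<le> (\<bar>C\<bar> + 1) * norm (y - x)" by (intro mult_right_mono) auto
      also have "\<dots> < - a"
        using mult_strict_left_mono[OF small, of "\<bar>C\<bar> + 1"] by simp
      finally have "a \<le> - C * norm (y - x)" by simp
      then have "a * norm (y - x) \<le> - C * norm (y - x) * norm (y - x)"
        using y(1) by (intro mult_right_mono) simp_all
      then have "a * norm (y - x) \<le> - (C * (norm (y - x))\<^sup>2)"
        by (simp add: power2_eq_square)
      then have "ereal a \<le> (f y - f x - ereal (v \<bullet> (y - x))) / ereal (norm (y - x))"
        using le[OF y(2)] y(1) by (cases "f y") (simp_all add: r pos_le_divide_eq)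
      with a show "e < (f y - f x - ereal (v \<bullet> (y - x))) / ereal (norm (y - x))" by simp
    qed
  qed
  with fin show ?thesis by (simp add: regular_subdiff_def)
qed

lemma regular_subdiff_imp_limiting:
  "v \<in> regular_subdiff f x \<Longrightarrow> v \<in> limiting_subdiff f x"
  unfolding limiting_subdiff_def regular_subdiff_def
  by (intro CollectI conjI exI[of _ "\<lambda>_. x"] exI[of _ "\<lambda>_. v"]) auto

lemma closed_fun_eventually_less:
  assumes "closed_fun f" "c < f x"
  shows "\<forall>\<^sub>F y in nhds x. c < f y"
proof -
  have "c < Liminf (at x) f" using assms by (auto simp: closed_fun_def intro: less_le_trans)
  then have "\<forall>\<^sub>F y in at x. c < f y" by (rule less_LiminfD)
  with assms(2) show ?thesis by (auto simp: eventually_nhds_conv_at)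
qed

section \<open>Minimality inequalities of proximal points\<close>

lemma proxD:
  assumes "u \<in> prox f q" "proper_fun f"
  shows prox_finite: "\<bar>f u\<bar> \<noteq> \<infinity>"
    and prox_le: "f u + ereal (1 / 2 * (norm (u - q))\<^sup>2) \<le> f y + ereal (1 / 2 * (norm (y - q))\<^sup>2)"
proof -
  show le: "f u + ereal (1 / 2 * (norm (u - q))\<^sup>2) \<le> f y + ereal (1 / 2 * (norm (y - q))\<^sup>2)" for y
    using assms(1) by (auto simp: prox_def is_arg_min_def not_less)
  obtain p where "f p \<noteq> \<infinity>" using assms(2) by (auto simp: proper_fun_def)
  with le[of p] assms(2) show "\<bar>f u\<bar> \<noteq> \<infinity>"
    by (cases "f p"; cases "f u") (auto simp: proper_fun_def)
qed

text \<open>Expanding the squares in the minimality inequality turns the residual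
  \<open>q - u\<close> into a global proximal subgradient with constant 1/2, with no convexity of
  \<open>f\<close>.\<close>

lemma prox_subgradient:
  fixes u :: "'a::real_inner"
  assumes "u \<in> prox f q" "proper_fun f"
  shows "f u + ereal ((q - u) \<bullet> (y - u) - 1 / 2 * (norm (y - u))\<^sup>2) \<le> f y"
proof -
  have "1 / 2 * (norm (u - q))\<^sup>2 - 1 / 2 * (norm (y - q))\<^sup>2 = (q - u) \<bullet> (y - u) - 1 / 2 * (norm (y - u))\<^sup>2"
    by (simp add: power2_norm_eq_inner inner_diff_left inner_diff_right inner_commute field_simps)
  with prox_le[OF assms, of y] prox_finite[OF assms] show ?thesis
    by (cases "f u"; cases "f y") auto
qed

section \<open>Finite length from the Kurdyka--Lojasiewicz inequality\<close>

lemma concave_on_tangent: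
  fixes \<Psi> :: "real \<Rightarrow> real"
  assumes "concave_on {a..<b} \<Psi>" "(\<Psi> has_real_derivative D) (at s)" "s \<in> {a<..<b}" "t \<in> {a..<b}"
  shows "D * (s - t) \<le> \<Psi> s - \<Psi> t"
proof -
  have 1: "convex_on {a..<b} (\<lambda>x. - \<Psi> x)" using assms(1) by (simp add: concave_on_def)
  have 2: "s \<in> interior {a..<b}" using assms(3) by (simp add: interior_atLeastLessThan)
  have 3: "((\<lambda>x. - \<Psi> x) has_real_derivative - D) (at s within {a..<b})"
    by (intro DERIV_minus has_field_derivative_at_within[OF assms(2)])
  have 4: "connected {a..<b}" by (simp add: is_interval_connected_1[symmetric] is_interval_co)
  have "- \<Psi> t - (- \<Psi> s) \<ge> - D * (t - s)"
    using convex_on_imp_above_tangent[OF 1 4 2 assms(4) 3] .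
  then show ?thesis by (simp add: algebra_simps)
qed
lemma sufficient_descent_vanishing:
  fixes T d :: "nat \<Rightarrow> real"
  assumes descent: "\<And>k. T (Suc k) \<le> T k - a * (d k)\<^sup>2" and "0 < a" and T: "T \<longlonglongrightarrow> \<tau>"
  shows "d \<longlonglongrightarrow> 0"
proof -
  have "(\<lambda>k. (d k)\<^sup>2) \<longlonglongrightarrow> 0"
  proof (rule tendsto_sandwich[where f = "\<lambda>_. 0" and h = "\<lambda>k. (T k - T (Suc k)) / a"])
    show "(\<lambda>k. (T k - T (Suc k)) / a) \<longlonglongrightarrow> 0"
      using tendsto_divide_zero[OF tendsto_diff[OF T LIMSEQ_Suc[OF T], simplified]] .
    show "\<forall>\<^sub>F k in sequentially. (d k)\<^sup>2 \<le> (T k - T (Suc k)) / a"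
    proof (intro always_eventually allI)
      fix k show "(d k)\<^sup>2 \<le> (T k - T (Suc k)) / a"
        using descent[of k] \<open>0 < a\<close> by (simp add: pos_le_divide_eq mult.commute)
    qed
  qed simp_all
  then show ?thesis by (simp only: power_tendsto_0_iff zero_less_numeral)
qed

text \<open>The KL inequality is local, so the point is to keep all later iterates in the ball
  around the cluster point. \<open>KL\<close> also asks for \<open>d k < \<rho>\<close> because
  \<open>X\<close> will be the x-component only: closeness of the full triple to its limit needs a
  small step as well.\<close>

lemma KL_finite_length:
  fixes X :: "nat \<Rightarrow> 'a::real_normed_vector" and T :: "nat \<Rightarrow> real"
  defines "d \<equiv> \<lambda>k. norm (X (Suc k) - X k)"
  assumes descent: "\<And>k. T (Suc k) \<le> T k - a * (d k)\<^sup>2" and "0 < a"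
    and T: "T \<longlonglongrightarrow> \<tau>"
    and cluster: "strict_mono r" "(X \<circ> r) \<longlonglongrightarrow> z"
    and pos: "0 < \<delta>" "0 < \<rho>" "0 < C"
    and \<Psi>: "\<forall>t\<in>{0..<\<delta>}. 0 \<le> \<Psi> t" "\<Psi> 0 = 0" "concave_on {0..<\<delta>} \<Psi>" "continuous_on {0..<\<delta>} \<Psi>"
      "\<forall>t\<in>{0<..<\<delta>}. (\<Psi> has_real_derivative \<Psi>' t) (at t)"
    and KL: "\<And>k. norm (X k - z) < \<rho> \<Longrightarrow> d k < \<rho> \<Longrightarrow> \<tau> < T k \<Longrightarrow> T k < \<tau> + \<delta> \<Longrightarrow>
      1 \<le> \<Psi>' (T k - \<tau>) * (C * d k)"
  shows "summable d"
proof -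
  have d0: "0 \<le> d k" for k by (simp add: d_def)
  have "T (Suc k) \<le> T k" for k
  proof -
    have "0 \<le> a * (d k)\<^sup>2" using \<open>0 < a\<close> by simp
    with descent[of k] show ?thesis by linarith
  qed
  then have "decseq T" by (rule decseq_SucI)
  then have limit_le: "\<tau> \<le> T k" for k using T by (rule decseq_ge)
  show ?thesis
  \<comment> \<open>If the limit value is attained, \<open>T\<close> is constant from there on and
    the descent forces the steps to vanish. Otherwise \<open>T k\<close> stays strictly above
    \<tau>, as the KL inequality requires.\<close>
  proof (cases "\<exists>K. T K = \<tau>")
    case True
    then obtain K where "T K = \<tau>" by blast
    then have const: "T k = \<tau>" if "K \<le> k" for k
      using decseqD[OF \<open>decseq T\<close> that] limit_le[of k] by simp
    have "d k = 0" if "K \<le> k" for k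
    proof -
      have "a * (d k)\<^sup>2 \<le> 0" using descent[of k] const[of k] const[of "Suc k"] that by simp
      with \<open>0 < a\<close> show ?thesis by (simp add: mult_le_0_iff)
    qed
    then show ?thesis by (intro summable_finite[of "{..<K}"]) (auto simp: not_less)
  next
    case False
    then have gt: "\<tau> < T k" for k using limit_le[of k] by (simp add: order.order_iff_strict eq_commute)
    have step: "a / C * d k \<le> \<Psi> (T k - \<tau>) - \<Psi> (T (Suc k) - \<tau>)"
      if k: "norm (X k - z) < \<rho>" "d k < \<rho>" "T k < \<tau> + \<delta>" for k
    proof -
      define s t where "s = T k - \<tau>" and "t = T (Suc k) - \<tau>"
      have s: "s \<in> {0<..<\<delta>}" using gt[of k] k by (simp add: s_def)
      have t: "t \<in> {0..<\<delta>}" using limit_le[of "Suc k"] decseqD[OF \<open>decseq T\<close>, of k "Suc k"] k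
        by (simp add: t_def)
      have 1: "1 \<le> \<Psi>' s * (C * d k)" using KL[OF k(1,2) gt k(3)] by (simp add: s_def)
      then have "d k \<noteq> 0" by auto
      with d0[of k] have "0 < d k" by linarith
      with pos(3) have Cd: "0 < C * d k" "0 < d k" by simp_all
      have "a * (d k)\<^sup>2 \<le> s - t" using descent[of k] by (simp add: s_def t_def)
      moreover have "1 / (C * d k) \<le> \<Psi>' s" using 1 Cd by (simp add: pos_divide_le_eq)
      moreover have "0 \<le> 1 / (C * d k)" "0 \<le> a * (d k)\<^sup>2" using Cd \<open>0 < a\<close> by simp_all
      \<comment> \<open>The lower bound on \<open>\<Psi>'\<close> has \<open>d k\<close> in the
        denominator and the decrease has its square, so the product is linear in
        \<open>d k\<close>.\<close>
      ultimately have slope: "1 / (C * d k) * (a * (d k)\<^sup>2) \<le> \<Psi>' s * (s - t)"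
        by (intro mult_mono) linarith+
      have "\<Psi>' s * (s - t) \<le> \<Psi> s - \<Psi> t"
        using concave_on_tangent[OF \<Psi>(3) _ s t] \<Psi>(5) s by blast
      moreover have "1 / (C * d k) * (a * (d k)\<^sup>2) = a / C * d k"
        using Cd(2) pos(3) by (simp add: power2_eq_square)
      ultimately show ?thesis using slope unfolding s_def t_def by linarith
    qed
    have Td: "\<forall>\<^sub>F k in sequentially. T k < \<tau> + \<delta>"
      by (rule order_tendstoD(2)[OF T]) (use pos in simp)
    have "d \<longlonglongrightarrow> 0" by (rule sufficient_descent_vanishing[OF descent \<open>0 < a\<close> T])
    then have dr: "\<forall>\<^sub>F k in sequentially. d k < \<rho>" by (rule order_tendstoD(2)) (rule pos(2))
    have "((\<lambda>k. \<Psi> (T k - \<tau>)) \<longlongrightarrow> \<Psi> 0) sequentially"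
    proof (rule continuous_on_tendsto_compose[OF \<Psi>(4)])
      show "(\<lambda>k. T k - \<tau>) \<longlonglongrightarrow> 0" using tendsto_diff[OF T tendsto_const, of \<tau>] by simp
      show "\<forall>\<^sub>F k in sequentially. T k - \<tau> \<in> {0..<\<delta>}"
        using Td by eventually_elim (use limit_le in auto)
    qed (use pos in simp)
    then have \<Psi>lim: "(\<lambda>k. C / a * \<Psi> (T k - \<tau>)) \<longlonglongrightarrow> 0" unfolding \<Psi>(2) by (rule tendsto_mult_right_zero)
    have "\<forall>\<^sub>F k in sequentially. C / a * \<Psi> (T k - \<tau>) < \<rho> / 2"
      by (rule order_tendstoD(2)[OF \<Psi>lim]) (use pos in simp)
    with Td dr have "\<forall>\<^sub>F k in sequentially. T k < \<tau> + \<delta> \<and> d k < \<rho> \<and> C / a * \<Psi> (T k - \<tau>) < \<rho> / 2"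
      by eventually_elim blast
    then obtain N where "\<forall>k\<ge>N. T k < \<tau> + \<delta> \<and> d k < \<rho> \<and> C / a * \<Psi> (T k - \<tau>) < \<rho> / 2"
      unfolding eventually_sequentially ..
    then have N: "T k < \<tau> + \<delta>" "d k < \<rho>" "C / a * \<Psi> (T k - \<tau>) < \<rho> / 2" if "N \<le> k" for k
      using that by simp_all
    have "\<forall>\<^sub>F j in sequentially. dist ((X \<circ> r) j) z < \<rho> / 2"
      by (rule tendstoD[OF cluster(2)]) (use pos in simp)
    then obtain M where "\<forall>j\<ge>M. dist ((X \<circ> r) j) z < \<rho> / 2"
      unfolding eventually_sequentially ..
    then have M: "norm (X (r j) - z) < \<rho> / 2" if "M \<le> j" for j
      using that by (simp add: dist_norm)
    \<comment> \<open>A starting index taken from the subsequence: within \<open>\<rho> / 2\<close>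
      of the cluster point, and late enough that the length still available,
      \<open>C / a * \<Psi> (T K - \<tau>)\<close>, is below \<open>\<rho> / 2\<close>.\<close>
    define K where "K = r (max M N)"
    have K: "N \<le> K" using seq_suble[OF cluster(1), of "max M N"] by (simp add: K_def)
    have XK: "norm (X K - z) < \<rho> / 2" using M[of "max M N"] by (simp add: K_def)
    have \<Psi>0: "0 \<le> \<Psi> (T k - \<tau>)" if "K \<le> k" for k
    proof -
      have "T k - \<tau> \<in> {0..<\<delta>}" using N(1)[of k] K that limit_le[of k] by auto
      with \<Psi>(1) show ?thesis by blast
    qed
    have drop: "C / a * (\<Psi> (T K - \<tau>) - \<Psi> (T (K + n) - \<tau>)) \<le> C / a * \<Psi> (T K - \<tau>)" for n
    proof (rule mult_left_mono)
      show "\<Psi> (T K - \<tau>) - \<Psi> (T (K + n) - \<tau>) \<le> \<Psi> (T K - \<tau>)" using \<Psi>0[of "K + n"] by simp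
      show "0 \<le> C / a" using pos \<open>0 < a\<close> by simp
    qed
    \<comment> \<open>Both bounds are carried through the induction together: the length bound keeps
      \<open>X (K + n)\<close> within \<rho> of \<open>z\<close>, which is what permits the next
      application of \<open>step\<close>.\<close>
    have claim: "norm (X (K + n) - X K) \<le> (\<Sum>i<n. d (K + i)) \<and>
        (\<Sum>i<n. d (K + i)) \<le> C / a * (\<Psi> (T K - \<tau>) - \<Psi> (T (K + n) - \<tau>))" for n
    proof (induction n)
      case (Suc n)
      have "(\<Sum>i<n. d (K + i)) \<le> C / a * \<Psi> (T K - \<tau>)"
        using Suc drop[of n] by linarith
      with Suc have "norm (X (K + n) - X K) < \<rho> / 2" using N(3)[OF K] by linarith
      then have "norm (X (K + n) - z) < \<rho>"
        using XK norm_triangle_ineq[of "X (K + n) - X K" "X K - z"] by simp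
      then have "a / C * d (K + n) \<le> \<Psi> (T (K + n) - \<tau>) - \<Psi> (T (Suc (K + n)) - \<tau>)"
        using N(1,2)[of "K + n"] K by (intro step) simp_all
      then have "C / a * (a / C * d (K + n)) \<le> C / a * (\<Psi> (T (K + n) - \<tau>) - \<Psi> (T (Suc (K + n)) - \<tau>))"
        using pos \<open>0 < a\<close> by (intro mult_left_mono) simp_all
      moreover have "C / a * (a / C * d (K + n)) = d (K + n)"
        using pos \<open>0 < a\<close> by simp
      moreover have "norm (X (Suc (K + n)) - X K) \<le> norm (X (K + n) - X K) + d (K + n)"
        using norm_triangle_ineq[of "X (Suc (K + n)) - X (K + n)" "X (K + n) - X K"] by (simp add: d_def)
      ultimately show ?case
        using Suc unfolding add_Suc_right sum.lessThan_Suc right_diff_distrib by linarith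
    qed simp
    have "summable (\<lambda>i. d (K + i))"
    proof (rule summableI_nonneg_bounded)
      fix n
      have "(\<Sum>i<n. d (K + i)) \<le> C / a * (\<Psi> (T K - \<tau>) - \<Psi> (T (K + n) - \<tau>))"
        using claim by blast
      also have "\<dots> \<le> C / a * \<Psi> (T K - \<tau>)"
        by (rule drop)
      finally show "(\<Sum>i<n. d (K + i)) \<le> C / a * \<Psi> (T K - \<tau>)" .
    qed (rule d0)
    then show ?thesis using summable_iff_shift[of d K] by (simp add: add.commute)
  qed
qed

section \<open>Sufficient decrease\<close>

locale dys_iteration =
  fixes \<psi> \<phi>1 :: "'a::euclidean_space \<Rightarrow> real" and \<phi>2 :: "'a \<Rightarrow> ereal"
    and \<beta> l L \<gamma> \<eta> :: real
    and x u w :: "nat \<Rightarrow> 'a"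
  assumes psi_diff: "\<forall>p. \<psi> differentiable (at p)"
    and psi_lipschitz: "\<beta>-lipschitz_on UNIV (grad \<psi>)"
    and phi1_weakly_convex: "weakly_convex l \<phi>1"
    and phi1_diff: "\<forall>p. \<phi>1 differentiable (at p)"
    and phi1_lipschitz: "L-lipschitz_on UNIV (grad \<phi>1)"
    and phi2_proper: "proper_fun \<phi>2"
    and phi2_closed: "closed_fun \<phi>2"
    and gamma_pos: "0 < \<gamma>"
    and eta_range: "0 < \<eta>" "\<eta> \<le> 1"
    and Lambda_pos: "0 < Lambda \<beta> l L \<gamma> \<eta>"
    and x_step: "\<forall>k. prox (\<lambda>p. ereal (\<phi>1 p)) (w k) = {x (Suc k)}"
    and u_step: "\<forall>k. u (Suc k) \<in>
      prox \<phi>2 (2 *\<^sub>R x (Suc k) - w k - \<gamma> *\<^sub>R grad \<psi> (x (Suc k)))"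
    and w_step: "\<forall>k. w (Suc k) = w k + \<eta> *\<^sub>R (u (Suc k) - x (Suc k))"
begin

section \<open>The merit function and its data\<close>

abbreviation \<Theta> :: "'a \<times> 'a \<times> 'a \<Rightarrow> ereal" where
  "\<Theta> \<equiv> Theta \<psi> \<phi>1 \<phi>2 \<gamma> \<eta>"

definition \<Theta>\<^sub>r :: "'a \<Rightarrow> 'a \<Rightarrow> 'a \<Rightarrow> real" where
  "\<Theta>\<^sub>r p s r = \<psi> p + \<phi>1 p / \<gamma> + (p - r - \<gamma> *\<^sub>R grad \<psi> p) \<bullet> (p - s) / \<gamma>
     + (1 - 2 * \<eta>) / (2 * \<gamma>) * (norm (p - s))\<^sup>2"

text \<open>With \<open>a = p - r - \<gamma> grad \<psi> p\<close> and \<open>b = p - s\<close> the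
  two large squares are those of \<open>a + b\<close> and of \<open>- a\<close>, so the square of
  \<open>a\<close> cancels and only \<open>a \<bullet> b\<close> and the square of \<open>b\<close>
  remain. This separates a finite, continuous part from \<phi>2.\<close>

lemma Theta_eq: "\<Theta> (p, s, r) = ereal (\<Theta>\<^sub>r p s r) + ereal (1 / \<gamma>) * \<phi>2 s"
proof -
  define a b where "a = p - r - \<gamma> *\<^sub>R grad \<psi> p" and "b = p - s"
  have ab: "2 *\<^sub>R p - s - r - \<gamma> *\<^sub>R grad \<psi> p = a + b" "r - p + \<gamma> *\<^sub>R grad \<psi> p = - a"
    by (simp_all add: a_def b_def scaleR_2)
  have "1 / (2 * \<gamma>) * (norm (a + b))\<^sup>2 - 1 / (2 * \<gamma>) * (norm (- a))\<^sup>2 - \<eta> / \<gamma> * (norm b)\<^sup>2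
      = a \<bullet> b / \<gamma> + (1 - 2 * \<eta>) / (2 * \<gamma>) * (norm b)\<^sup>2"
    using gamma_pos
    by (simp add: power2_norm_eq_inner inner_add_left inner_add_right inner_commute[of b a] field_simps)
  then show ?thesis
    using gamma_pos
    by (cases "\<phi>2 s") (simp_all add: Theta_def ab \<Theta>\<^sub>r_def a_def[symmetric] b_def[symmetric])
qed

lemma beta_nonneg: "0 \<le> \<beta>" and L_nonneg: "0 \<le> L"
  using psi_lipschitz phi1_lipschitz by (auto dest: lipschitz_on_nonneg)

lemma grad_psi_lipschitz: "norm (grad \<psi> p - grad \<psi> q) \<le> \<beta> * norm (p - q)"
  using lipschitz_onD[OF psi_lipschitz, of p q] by (simp add: dist_norm)

lemma grad_phi1_lipschitz: "norm (grad \<phi>1 p - grad \<phi>1 q) \<le> L * norm (p - q)"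
  using lipschitz_onD[OF phi1_lipschitz, of p q] by (simp add: dist_norm)

lemmas psi_bounds = lipschitz_gradient_bounds[OF psi_diff psi_lipschitz]
lemmas phi1_bounds = lipschitz_gradient_bounds[OF phi1_diff phi1_lipschitz]

lemma isCont_data: "isCont \<psi> p" "isCont \<phi>1 p" "isCont (grad \<psi>) p" "isCont (grad \<phi>1) p"
proof -
  show "isCont \<psi> p" "isCont \<phi>1 p"
    using psi_diff phi1_diff by (simp_all add: differentiable_imp_continuous_within)
  show "isCont (grad \<psi>) p" "isCont (grad \<phi>1) p"
    using lipschitz_on_continuous_on[OF psi_lipschitz] lipschitz_on_continuous_on[OF phi1_lipschitz]
    by (simp_all add: continuous_on_eq_continuous_at)
qed

lemmas data_tendsto = isCont_tendsto_compose[OF isCont_data(1)] isCont_tendsto_compose[OF isCont_data(2)]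
  isCont_tendsto_compose[OF isCont_data(3)] isCont_tendsto_compose[OF isCont_data(4)]

lemma Theta_r_tendsto:
  assumes "(f \<longlongrightarrow> p) F" "(g \<longlongrightarrow> s) F" "(h \<longlongrightarrow> r) F"
  shows "((\<lambda>k. \<Theta>\<^sub>r (f k) (g k) (h k)) \<longlongrightarrow> \<Theta>\<^sub>r p s r) F"
  unfolding \<Theta>\<^sub>r_def using gamma_pos by (intro tendsto_intros data_tendsto assms) auto

lemma proper_phi1: "proper_fun (\<lambda>p. ereal (\<phi>1 p))"
  by (simp add: proper_fun_def)

lemma x_in_prox: "x (Suc k) \<in> prox (\<lambda>p. ereal (\<phi>1 p)) (w k)"
  using x_step by simp

text \<open>The objective of the proximal problem is \<open>1 - l\<close> strongly convex, so it grows at least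
  quadratically away from its minimizer; this improves the constant \<open>1 / 2\<close> of
  \<open>prox_subgradient\<close> to \<open>l / 2\<close>.\<close>

lemma phi1_above: "\<phi>1 (x (Suc k)) + (w k - x (Suc k)) \<bullet> (p - x (Suc k)) - l / 2 * (norm (p - x (Suc k)))\<^sup>2 \<le> \<phi>1 p"
proof -
  define z d where "z = x (Suc k)" and "d = p - x (Suc k)"
  define g where "g q = \<phi>1 q + l / 2 * (norm q)\<^sup>2" for q
  have conv: "convex_on UNIV g" using phi1_weakly_convex by (simp only: weakly_convex_def g_def[abs_def])
  have "\<forall>\<^sub>F t in at_right 0. (w k - z) \<bullet> d - l / 2 * (norm d)\<^sup>2 - t * ((1 - l) / 2 * (norm d)\<^sup>2) \<le> \<phi>1 p - \<phi>1 z"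
    unfolding eventually_at_right_field
  proof (intro exI[of _ 1] conjI allI impI)
    fix t :: real assume t: "0 < t" "t < 1"
    have "g (z + t *\<^sub>R d) \<le> (1 - t) * g z + t * g p"
      using convex_onD[OF conv, of t z p] t by (simp add: z_def d_def algebra_simps)
    then have "\<phi>1 (z + t *\<^sub>R d) + l / 2 * (norm (z + t *\<^sub>R d))\<^sup>2
        \<le> (1 - t) * \<phi>1 z + (1 - t) * (l / 2 * (norm z)\<^sup>2) + (t * \<phi>1 p + t * (l / 2 * (norm p)\<^sup>2))"
      by (simp only: g_def distrib_left)
    moreover have nsq: "(norm (z + t *\<^sub>R d))\<^sup>2 = (1 - t) * (norm z)\<^sup>2 + t * (norm p)\<^sup>2 - t * (1 - t) * (norm d)\<^sup>2"
      by (simp add: z_def d_def power2_norm_eq_inner inner_simps inner_commute algebra_simps)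
    have "l / 2 * (norm (z + t *\<^sub>R d))\<^sup>2 = (1 - t) * (l / 2 * (norm z)\<^sup>2) + t * (l / 2 * (norm p)\<^sup>2)
        - l / 2 * (t * (1 - t) * (norm d)\<^sup>2)"
      unfolding nsq by (simp add: field_simps)
    ultimately have "\<phi>1 (z + t *\<^sub>R d) \<le> (1 - t) * \<phi>1 z + t * \<phi>1 p + l / 2 * (t * (1 - t) * (norm d)\<^sup>2)"
      by linarith
    \<comment> \<open>The crude constant 1/2 is harmless here: at displacement \<open>t d\<close>
      its term is of order t squared, so after division by t it vanishes in the limit.\<close>
    moreover have "\<phi>1 z + (w k - z) \<bullet> (t *\<^sub>R d) - 1 / 2 * (norm (t *\<^sub>R d))\<^sup>2 \<le> \<phi>1 (z + t *\<^sub>R d)"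
      using prox_subgradient[OF x_in_prox[of k] proper_phi1, of "z + t *\<^sub>R d"] by (simp add: z_def)
    ultimately have "t * ((w k - z) \<bullet> d - l / 2 * (norm d)\<^sup>2 - t * ((1 - l) / 2 * (norm d)\<^sup>2)) \<le> t * (\<phi>1 p - \<phi>1 z)"
      using t by (simp add: power2_eq_square field_simps)
    with t show "(w k - z) \<bullet> d - l / 2 * (norm d)\<^sup>2 - t * ((1 - l) / 2 * (norm d)\<^sup>2) \<le> \<phi>1 p - \<phi>1 z"
      by simp
  qed simp
  moreover have "((\<lambda>t. (w k - z) \<bullet> d - l / 2 * (norm d)\<^sup>2 - t * ((1 - l) / 2 * (norm d)\<^sup>2)) \<longlongrightarrow>
      (w k - z) \<bullet> d - l / 2 * (norm d)\<^sup>2 - 0 * ((1 - l) / 2 * (norm d)\<^sup>2)) (at_right 0)"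
    by (intro tendsto_intros)
  ultimately have "(w k - z) \<bullet> d - l / 2 * (norm d)\<^sup>2 - 0 * ((1 - l) / 2 * (norm d)\<^sup>2) \<le> \<phi>1 p - \<phi>1 z"
    by (intro tendsto_upperbound) auto
  then show ?thesis by (simp add: z_def d_def)
qed

text \<open>The proximal subgradient \<open>w k - x (Suc k)\<close> minorizes \<phi>1 to second
  order and the gradient majorizes it to second order, so the two slopes agree.\<close>

lemma w_eq: "w k = x (Suc k) + grad \<phi>1 (x (Suc k))"
proof -
  have "norm ((w k - x (Suc k)) - grad \<phi>1 (x (Suc k))) \<le> 0"
  proof (rule subgradient_near_gradient[of 1])
    fix y
    show "(w k - x (Suc k)) \<bullet> (y - x (Suc k)) - l / 2 * (norm (y - x (Suc k)))\<^sup>2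
        \<le> grad \<phi>1 (x (Suc k)) \<bullet> (y - x (Suc k)) + 0 * norm (y - x (Suc k)) + L / 2 * (norm (y - x (Suc k)))\<^sup>2"
      using phi1_above[of k y] phi1_bounds[of y "x (Suc k)"] unfolding abs_le_iff by linarith
  qed simp_all
  then show ?thesis by (simp add: algebra_simps)
qed

text \<open>The indices start at 1 because the initial triple is arbitrary: \<open>w_eq\<close>,
  \<open>x_minus_u\<close> and the finiteness of \<phi>2 at \<open>u\<close> concern only
  \<open>x (Suc k)\<close> and \<open>u (Suc k)\<close>. For the same reason \<open>T k\<close>
  below belongs to the triple with index \<open>Suc k\<close>.\<close>

definition step :: "nat \<Rightarrow> real" where
  "step k = norm (x (Suc (Suc k)) - x (Suc k))"

lemma step_nonneg: "0 \<le> step k" by (simp add: step_def)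

lemma x_minus_u: "x (Suc k) - u (Suc k) = - (1 / \<eta>) *\<^sub>R (w (Suc k) - w k)"
  using w_step eta_range by simp

lemma norm_w_diff: "norm (w (Suc k) - w k) \<le> (1 + L) * step k"
proof -
  have "w (Suc k) - w k = (x (Suc (Suc k)) - x (Suc k)) + (grad \<phi>1 (x (Suc (Suc k))) - grad \<phi>1 (x (Suc k)))"
    by (simp add: w_eq)
  also have "norm \<dots> \<le> step k + L * step k"
    unfolding step_def by (intro norm_triangle_mono order_refl grad_phi1_lipschitz)
  finally show ?thesis by (simp add: algebra_simps)
qed

lemma norm_x_minus_u: "norm (x (Suc k) - u (Suc k)) \<le> (1 + L) / \<eta> * step k"
proof -
  have "norm (x (Suc k) - u (Suc k)) = norm (w (Suc k) - w k) / \<eta>"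
    using eta_range by (simp add: x_minus_u)
  also have "\<dots> \<le> (1 + L) * step k / \<eta>"
    using eta_range by (intro divide_right_mono norm_w_diff) simp
  finally show ?thesis by simp
qed

lemma phi2_u_finite: "\<bar>\<phi>2 (u (Suc k))\<bar> \<noteq> \<infinity>"
  using prox_finite[OF u_step[rule_format] phi2_proper] .

definition phi2_val :: "nat \<Rightarrow> real" where
  "phi2_val k = real_of_ereal (\<phi>2 (u (Suc k)))"

lemma phi2_u: "\<phi>2 (u (Suc k)) = ereal (phi2_val k)"
  using phi2_u_finite[of k] by (simp add: phi2_val_def ereal_real)

definition T :: "nat \<Rightarrow> real" where
  "T k = \<Theta>\<^sub>r (x (Suc k)) (u (Suc k)) (w (Suc k)) + phi2_val k / \<gamma>"

text \<open>Origin of the terms of \<open>Lambda\<close>, after multiplication by \<gamma>: in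
  \<open>(1 + l) / 2\<close> the 1/2 comes from the minimality of the new \<open>u\<close>, the
  \<open>l / 2\<close> from weak convexity of \<phi>1; \<open>(1 - L\<^sup>2) / \<eta>\<close> comes
  from the exact square in fact 6. In \<beta> times \<open>1 + c\<^sup>2 / 2\<close>, one half is
  the descent lemma for \<psi> and the rest is the gradient variation in fact 7.\<close>

lemma descent: "T (Suc k) \<le> T k - Lambda \<beta> l L \<gamma> \<eta> * (step k)\<^sup>2"
proof -
  define p p' s s' r r' where "p = x (Suc k)" and "p' = x (Suc (Suc k))" and "s = u (Suc k)"
    and "s' = u (Suc (Suc k))" and "r = w (Suc k)" and "r' = w (Suc (Suc k))"
  define G G' where "G = grad \<psi> p" and "G' = grad \<psi> p'"
  define d e g where "d = p' - p" and "e = p - s" and "g = grad \<phi>1 p' - grad \<phi>1 p"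
  define a b where "a = p' - r - \<gamma> *\<^sub>R G'" and "b = p' - s'"
  define c where "c = (1 - \<eta> + L) / \<eta>"
  have d: "norm d = step k" by (simp add: d_def p_def p'_def step_def)
  have g: "norm g \<le> L * norm d" by (simp add: g_def d_def grad_phi1_lipschitz)
  have e: "e = - (1 / \<eta>) *\<^sub>R (d + g)"
    using x_minus_u[of k] by (simp add: e_def p_def s_def d_def g_def p'_def w_eq algebra_simps)

  \<comment> \<open>The new \<open>s'\<close> is compared with the old \<open>s\<close>; in the
    expansion the mixed term \<open>b \<bullet> (e + d)\<close> cancels.\<close>
  have "phi2_val (Suc k) + ((2 *\<^sub>R p' - r - \<gamma> *\<^sub>R G' - s') \<bullet> (s - s') - 1 / 2 * (norm (s - s'))\<^sup>2) \<le> phi2_val k"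
    using prox_subgradient[OF u_step[rule_format, of "Suc k"] phi2_proper, of s]
    by (simp add: phi2_u s_def s'_def p'_def r_def G'_def)
  moreover have "2 *\<^sub>R p' - r - \<gamma> *\<^sub>R G' - s' = a + b" "s - s' = b - (e + d)"
    by (simp_all add: a_def b_def e_def d_def scaleR_2)
  ultimately have "phi2_val (Suc k) + ((a + b) \<bullet> (b - (e + d)) - 1 / 2 * (norm (b - (e + d)))\<^sup>2) \<le> phi2_val k"
    by simp
  then have 1: "phi2_val (Suc k) + a \<bullet> b + 1 / 2 * (norm b)\<^sup>2 \<le> phi2_val k + a \<bullet> (e + d) + 1 / 2 * (norm (e + d))\<^sup>2"
    by (simp add: power2_norm_eq_inner inner_simps inner_commute algebra_simps)

  \<comment> \<open>The update of \<open>w\<close> shifts \<open>a\<close> by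
    \<open>\<eta> b\<close>, which adds \<eta> times the square of \<open>b\<close>. This is exactly
    compensated by the last term of \<open>Theta\<close>, so \<eta> disappears from the new merit
    value.\<close>
  have r': "p' - r' - \<gamma> *\<^sub>R G' = a + \<eta> *\<^sub>R b"
    using w_step by (simp add: a_def b_def r'_def r_def p'_def s'_def algebra_simps)
  then have ab: "(p' - r' - \<gamma> *\<^sub>R G') \<bullet> b = a \<bullet> b + \<eta> * (norm b)\<^sup>2"
    by (simp add: inner_add_left power2_norm_eq_inner)
  have T': "\<gamma> * T (Suc k) = \<gamma> * \<psi> p' + \<phi>1 p' + phi2_val (Suc k) + a \<bullet> b + 1 / 2 * (norm b)\<^sup>2"
    unfolding T_def \<Theta>\<^sub>r_def p'_def[symmetric] s'_def[symmetric] r'_def[symmetric] G'_def[symmetric]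
      b_def[symmetric] ab
    using gamma_pos by (simp add: field_simps)
  have T: "\<gamma> * T k = \<gamma> * \<psi> p + \<phi>1 p + phi2_val k + (p - r - \<gamma> *\<^sub>R G) \<bullet> e + (1 / 2 - \<eta>) * (norm e)\<^sup>2"
    unfolding T_def \<Theta>\<^sub>r_def
    using gamma_pos
    by (simp add: p_def[symmetric] s_def[symmetric] r_def[symmetric] G_def[symmetric] e_def[symmetric] field_simps)

  have 2: "\<phi>1 p' - \<phi>1 p \<le> (r - p') \<bullet> d + l / 2 * (norm d)\<^sup>2"
  proof -
    have "\<phi>1 p' + (r - p') \<bullet> (- d) - l / 2 * (norm (- d))\<^sup>2 \<le> \<phi>1 p"
      using phi1_above[of "Suc k" p] by (simp add: p'_def r_def d_def)
    then show ?thesis by simp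
  qed
  have 3: "\<psi> p' - \<psi> p \<le> G \<bullet> d + \<beta> / 2 * (norm d)\<^sup>2"
    using psi_bounds[of p' p] unfolding G_def d_def abs_le_iff by linarith
  have 4: "a \<bullet> (e + d) - (p - r - \<gamma> *\<^sub>R G) \<bullet> e + (r - p') \<bullet> d = d \<bullet> e - \<gamma> * (G' \<bullet> (e + d)) + \<gamma> * (G \<bullet> e)"
    by (simp add: a_def d_def inner_simps algebra_simps)
  have 5: "1 / 2 * (norm (e + d))\<^sup>2 = 1 / 2 * (norm e)\<^sup>2 + d \<bullet> e + 1 / 2 * (norm d)\<^sup>2"
    by (simp add: power2_norm_eq_inner inner_simps inner_commute algebra_simps)
  \<comment> \<open>Since \<open>\<eta> e = - (d + g)\<close>, completing the square cancels the
    mixed terms \<open>d \<bullet> g\<close> and leaves the difference of the squares of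
    \<open>g\<close> and \<open>d\<close>, divided by \<eta>.\<close>
  have 6: "\<eta> * (norm e)\<^sup>2 + 2 * (d \<bullet> e) \<le> - (1 - L\<^sup>2) / \<eta> * (norm d)\<^sup>2"
  proof -
    have "\<eta> * (norm e)\<^sup>2 = 1 / \<eta> * (norm (d + g))\<^sup>2"
      using eta_range by (simp add: e power2_eq_square)
    moreover have "2 * (d \<bullet> e) = - (1 / \<eta>) * (2 * (d \<bullet> (d + g)))"
      by (simp add: e)
    ultimately have "\<eta> * (norm e)\<^sup>2 + 2 * (d \<bullet> e) = 1 / \<eta> * ((norm (d + g))\<^sup>2 - 2 * (d \<bullet> (d + g)))"
      by (simp add: right_diff_distrib)
    also have "\<dots> = 1 / \<eta> * ((norm g)\<^sup>2 - (norm d)\<^sup>2)"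
      by (simp add: power2_norm_eq_inner inner_simps inner_commute)
    also have "\<dots> \<le> 1 / \<eta> * ((L * norm d)\<^sup>2 - (norm d)\<^sup>2)"
      using eta_range g by (intro mult_left_mono diff_right_mono power_mono) auto
    also have "\<dots> = - (1 - L\<^sup>2) / \<eta> * (norm d)\<^sup>2"
      using eta_range by (simp add: power_mult_distrib field_simps)
    finally show ?thesis .
  qed
  \<comment> \<open>Here \<open>e + d\<close> is the new x minus the old u, of size at most
    \<open>c\<close> times the step; then \<open>c \<le> 1 / 2 + c\<^sup>2 / 2\<close>.\<close>
  have 7: "- ((G' - G) \<bullet> (e + d)) \<le> \<beta> * (1 / 2 + c\<^sup>2 / 2) * (norm d)\<^sup>2"
  proof -
    have ed: "e + d = - (1 / \<eta>) *\<^sub>R ((1 - \<eta>) *\<^sub>R d + g)"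
      using eta_range by (simp add: e algebra_simps)
    have "norm ((1 - \<eta>) *\<^sub>R d + g) \<le> (1 - \<eta>) * norm d + L * norm d"
      using norm_triangle_ineq[of "(1 - \<eta>) *\<^sub>R d" g] g eta_range by simp
    then have "norm ((1 - \<eta>) *\<^sub>R d + g) / \<eta> \<le> ((1 - \<eta>) * norm d + L * norm d) / \<eta>"
      using eta_range by (intro divide_right_mono) auto
    moreover have "norm (e + d) = norm ((1 - \<eta>) *\<^sub>R d + g) / \<eta>"
      unfolding ed using eta_range by simp
    ultimately have "norm (e + d) \<le> c * norm d"
      by (simp add: c_def distrib_right)
    then have "norm (G' - G) * norm (e + d) \<le> (\<beta> * norm d) * (c * norm d)"
      using grad_psi_lipschitz[of p' p] beta_nonneg
      by (intro mult_mono) (auto simp: G_def G'_def d_def)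
    moreover have "\<bar>(G' - G) \<bullet> (e + d)\<bar> \<le> norm (G' - G) * norm (e + d)"
      by (rule Cauchy_Schwarz_ineq2)
    ultimately have "- ((G' - G) \<bullet> (e + d)) \<le> \<beta> * (norm d)\<^sup>2 * c"
      by (simp add: power2_eq_square algebra_simps)
    also have "\<dots> \<le> \<beta> * (norm d)\<^sup>2 * (1 / 2 + c\<^sup>2 / 2)"
      using beta_nonneg sum_squares_bound[of 1 c] by (intro mult_left_mono) (simp_all add: power2_eq_square)
    finally show ?thesis by (simp add: algebra_simps)
  qed
  have "((1 + l) / 2 - (1 - L\<^sup>2) / \<eta>) * (norm d)\<^sup>2
      = 1 / 2 * (norm d)\<^sup>2 + l / 2 * (norm d)\<^sup>2 + - (1 - L\<^sup>2) / \<eta> * (norm d)\<^sup>2"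
    by (simp add: left_diff_distrib distrib_right add_divide_distrib diff_divide_distrib)
  moreover have "\<gamma> * (\<psi> p' - \<psi> p - G' \<bullet> (e + d) + G \<bullet> e)
      = \<gamma> * \<psi> p' - \<gamma> * \<psi> p - \<gamma> * (G' \<bullet> (e + d)) + \<gamma> * (G \<bullet> e)"
    by (simp only: right_diff_distrib distrib_left)
  moreover have "(1 / 2 - \<eta>) * (norm e)\<^sup>2 = 1 / 2 * (norm e)\<^sup>2 - \<eta> * (norm e)\<^sup>2"
    by (simp only: left_diff_distrib)
  ultimately have "\<gamma> * T (Suc k) - \<gamma> * T k \<le> ((1 + l) / 2 - (1 - L\<^sup>2) / \<eta>) * (norm d)\<^sup>2
      + \<gamma> * (\<psi> p' - \<psi> p - G' \<bullet> (e + d) + G \<bullet> e)"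
    using 1 2 4 5 6 unfolding T T' by linarith
  \<comment> \<open>Splitting off \<open>- (G' - G) \<bullet> (e + d)\<close> leaves
    \<open>- G \<bullet> d\<close>, which cancels the linear term of the descent lemma for
    \<psi>.\<close>
  also have "\<psi> p' - \<psi> p - G' \<bullet> (e + d) + G \<bullet> e \<le> \<beta> * (1 + c\<^sup>2 / 2) * (norm d)\<^sup>2"
    using 3 7 by (simp add: inner_simps algebra_simps)
  finally have "\<gamma> * T (Suc k) - \<gamma> * T k \<le> ((1 + l) / 2 - (1 - L\<^sup>2) / \<eta>) * (norm d)\<^sup>2
      + \<gamma> * (\<beta> * (1 + c\<^sup>2 / 2) * (norm d)\<^sup>2)"
    using gamma_pos by simp
  also have "\<dots> = \<gamma> * (- Lambda \<beta> l L \<gamma> \<eta> * (norm d)\<^sup>2)"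
    using gamma_pos eta_range
    by (simp add: Lambda_def c_def power_divide field_simps)
  finally have "\<gamma> * T (Suc k) \<le> \<gamma> * (T k - Lambda \<beta> l L \<gamma> \<eta> * (norm d)\<^sup>2)"
    by (simp add: algebra_simps)
  then show ?thesis using gamma_pos d by simp
qed

section \<open>Subgradients of the merit function\<close>

text \<open>As a function of \<open>p\<close>, \<open>\<Theta>\<^sub>r\<close> need not be differentiable, since \<open>\<psi>\<close> is only \<open>C\<^sup>1\<close> with Lipschitz
  gradient; but its nonsmooth part is Lipschitz with the small constant \<open>\<beta> * norm (p - s)\<close>.\<close>

lemma Theta_r_upper:
  obtains C where "\<And>p'. \<Theta>\<^sub>r p' s r \<le> \<Theta>\<^sub>r p s r
    + ((1 / \<gamma>) *\<^sub>R (grad \<phi>1 p + p - r + (2 - 2 * \<eta>) *\<^sub>R (p - s))) \<bullet> (p' - p)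
    + \<beta> * norm (p - s) * norm (p' - p) + C * (norm (p' - p))\<^sup>2"
proof
  define \<kappa> where "\<kappa> = (1 - 2 * \<eta>) / (2 * \<gamma>)"
  fix p'
  define d G G' where "d = p' - p" and "G = grad \<psi> p" and "G' = grad \<psi> p'"
  have p': "p' = p + d" by (simp add: d_def)
  have 1: "\<psi> p' - \<psi> p \<le> G \<bullet> d + \<beta> / 2 * (norm d)\<^sup>2"
    using psi_bounds[of p' p] unfolding G_def d_def abs_le_iff by linarith
  have "\<phi>1 p' - \<phi>1 p \<le> grad \<phi>1 p \<bullet> d + L / 2 * (norm d)\<^sup>2"
    using phi1_bounds[of p' p] unfolding d_def abs_le_iff by linarith
  then have "(\<phi>1 p' - \<phi>1 p) / \<gamma> \<le> (grad \<phi>1 p \<bullet> d + L / 2 * (norm d)\<^sup>2) / \<gamma>"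
    using gamma_pos by (intro divide_right_mono) auto
  then have 2: "\<phi>1 p' / \<gamma> - \<phi>1 p / \<gamma> \<le> grad \<phi>1 p \<bullet> d / \<gamma> + L / (2 * \<gamma>) * (norm d)\<^sup>2"
    by (simp add: add_divide_distrib diff_divide_distrib)
  have GG: "norm (G' - G) \<le> \<beta> * norm d"
    unfolding G_def G'_def d_def by (rule grad_psi_lipschitz)
  \<comment> \<open>The only nonsmooth contribution. As \<open>p' - s = d + (p - s)\<close>, it
    splits into a quadratic part and the Lipschitz part with constant
    \<open>\<beta> * norm (p - s)\<close>.\<close>
  have "- ((G' - G) \<bullet> (p' - s)) \<le> norm (G' - G) * norm (p' - s)"
    using Cauchy_Schwarz_ineq2[of "G' - G" "p' - s"] by linarith
  also have "\<dots> \<le> (\<beta> * norm d) * (norm d + norm (p - s))"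
    using GG norm_triangle_ineq[of d "p - s"] beta_nonneg
    by (intro mult_mono) (auto simp: d_def)
  finally have 3: "- ((G' - G) \<bullet> (p' - s)) \<le> \<beta> * (norm d)\<^sup>2 + \<beta> * norm (p - s) * norm d"
    by (simp add: power2_eq_square algebra_simps)
  \<comment> \<open>The final \<open>- G \<bullet> d\<close> cancels the linear term of \<psi> in
    fact 1; this is why the candidate slope contains no \<open>grad \<psi>\<close>.\<close>
  have 4: "(p' - r - \<gamma> *\<^sub>R G') \<bullet> (p' - s) / \<gamma> - (p - r - \<gamma> *\<^sub>R G) \<bullet> (p - s) / \<gamma>
      = (p - r + (p - s)) \<bullet> d / \<gamma> + (norm d)\<^sup>2 / \<gamma> - (G' - G) \<bullet> (p' - s) - G \<bullet> d"
    using gamma_pos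
    by (simp add: p' power2_norm_eq_inner inner_simps inner_commute field_simps)
  have 5: "\<kappa> * (norm (p' - s))\<^sup>2 - \<kappa> * (norm (p - s))\<^sup>2 = 2 * \<kappa> * ((p - s) \<bullet> d) + \<kappa> * (norm d)\<^sup>2"
    by (simp add: p' power2_norm_eq_inner inner_simps inner_commute algebra_simps)
  have 6: "((1 / \<gamma>) *\<^sub>R (grad \<phi>1 p + p - r + (2 - 2 * \<eta>) *\<^sub>R (p - s))) \<bullet> d
      = grad \<phi>1 p \<bullet> d / \<gamma> + (p - r + (p - s)) \<bullet> d / \<gamma> + 2 * \<kappa> * ((p - s) \<bullet> d)"
    using gamma_pos by (simp add: \<kappa>_def inner_simps field_simps)
  show "\<Theta>\<^sub>r p' s r \<le> \<Theta>\<^sub>r p s r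
    + ((1 / \<gamma>) *\<^sub>R (grad \<phi>1 p + p - r + (2 - 2 * \<eta>) *\<^sub>R (p - s))) \<bullet> (p' - p)
    + \<beta> * norm (p - s) * norm (p' - p) + (\<beta> / 2 + L / (2 * \<gamma>) + 1 / \<gamma> + \<beta> + \<kappa>) * (norm (p' - p))\<^sup>2"
    using 1 2 3 4 5 unfolding \<Theta>\<^sub>r_def d_def[symmetric] G_def[symmetric] G'_def[symmetric] \<kappa>_def[symmetric] 6
    by (simp add: distrib_right)
qed

text \<open>Partial minorants in the first and second variable combine into a joint one because
  \<phi>2 depends on \<open>s\<close> alone and all coupling between increments is of second order:
  even the variation of \<open>grad \<psi>\<close> is multiplied by the increment of
  \<open>s\<close>.\<close>

lemma regular_subgradient_Theta:
  assumes fin: "\<bar>\<phi>2 s\<bar> \<noteq> \<infinity>"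
    and v: "\<And>q. \<phi>2 s + ereal (v \<bullet> (q - s) - 1 / 2 * (norm (q - s))\<^sup>2) \<le> \<phi>2 q"
    and "0 < \<rho>"
    and \<xi>: "\<And>q. norm (q - p) < \<rho> \<Longrightarrow> \<Theta>\<^sub>r p s r + \<xi> \<bullet> (q - p) - c * (norm (q - p))\<^sup>2 \<le> \<Theta>\<^sub>r q s r"
  shows "(\<xi>, (1 / \<gamma>) *\<^sub>R (v - (p - r - \<gamma> *\<^sub>R grad \<psi> p) - (1 - 2 * \<eta>) *\<^sub>R (p - s)), - (1 / \<gamma>) *\<^sub>R (p - s))
    \<in> regular_subdiff \<Theta> (p, s, r)"
proof -
  define \<kappa> where "\<kappa> = (1 - 2 * \<eta>) / (2 * \<gamma>)"
  define a b where "a = p - r - \<gamma> *\<^sub>R grad \<psi> p" and "b = p - s"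
  define \<upsilon> where "\<upsilon> = (1 / \<gamma>) *\<^sub>R (v - a - (1 - 2 * \<eta>) *\<^sub>R b)"
  \<comment> \<open>The summands are the curvature of the minorant in \<open>p\<close>, the four
    cross products in \<open>R\<close>, the \<kappa>-part of \<open>R\<close>, and the constant 1/2
    of the minorant of \<phi>2 divided by \<gamma>.\<close>
  define C where "C = \<bar>c\<bar> + (3 + \<gamma> * \<beta>) / \<gamma> + 3 * \<bar>\<kappa>\<bar> + 1 / (2 * \<gamma>)"
  obtain f where f: "\<phi>2 s = ereal f" using fin by (cases "\<phi>2 s") auto
  have "(\<xi>, \<upsilon>, - (1 / \<gamma>) *\<^sub>R b) \<in> regular_subdiff \<Theta> (p, s, r)"
  proof (rule regular_subdiffI[of _ _ \<rho> _ C])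
    show "\<bar>\<Theta> (p, s, r)\<bar> \<noteq> \<infinity>" by (simp add: Theta_eq f)
    show "0 < \<rho>" by (fact \<open>0 < \<rho>\<close>)
    fix z assume z: "norm (z - (p, s, r)) < \<rho>"
    obtain p' s' r' where z_eq: "z = (p', s', r')" by (cases z)
    define d e g where "d = p' - p" and "e = s' - s" and "g = r' - r"
    define N where "N = norm (z - (p, s, r))"
    have zd: "z - (p, s, r) = (d, e, g)" by (simp add: z_eq d_def e_def g_def)
    have dN: "norm d \<le> N" and eN: "norm e \<le> N" and gN: "norm g \<le> N"
      unfolding N_def zd
      using norm_fst_le[of d "(e, g)"] norm_snd_le[of "(e, g)" d] norm_fst_le[of e g] norm_snd_le[of g e]
      by auto
    have N0: "0 \<le> N" by (simp add: N_def)
    have sq: "(norm y)\<^sup>2 \<le> N\<^sup>2" if "norm y \<le> N" for y :: 'a using that by (intro power_mono) auto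
    have ip: "\<bar>y \<bullet> y'\<bar> \<le> N\<^sup>2" if "norm y \<le> N" "norm y' \<le> N" for y y' :: 'a
    proof -
      have "norm y * norm y' \<le> N * N" using that N0 by (intro mult_mono) auto
      then show ?thesis using Cauchy_Schwarz_ineq2[of y y'] by (simp add: power2_eq_square)
    qed
    define h where "h = grad \<psi> p' - grad \<psi> p"
    have h: "\<bar>h \<bullet> e\<bar> \<le> \<beta> * N\<^sup>2"
    proof -
      have "norm h \<le> \<beta> * N"
        using grad_psi_lipschitz[of p' p] mult_left_mono[OF dN beta_nonneg] by (simp add: h_def d_def)
      then have "norm h * norm e \<le> (\<beta> * N) * N"
        using eN N0 beta_nonneg by (intro mult_mono) auto
      then show ?thesis using Cauchy_Schwarz_ineq2[of h e] by (simp add: power2_eq_square)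
    qed
    have a': "p' - r - \<gamma> *\<^sub>R grad \<psi> p' = a + d - \<gamma> *\<^sub>R h"
      "p' - r' - \<gamma> *\<^sub>R grad \<psi> p' = a + d - \<gamma> *\<^sub>R h - g" "p' - s = b + d" "p' - s' = b + d - e"
      by (simp_all add: a_def b_def h_def d_def e_def g_def algebra_simps)
    define R where "R = (1 / \<gamma>) * (- (d \<bullet> e) + \<gamma> * (h \<bullet> e) - g \<bullet> d + g \<bullet> e) + \<kappa> * (- 2 * (d \<bullet> e) + (norm e)\<^sup>2)"
    have diff: "\<Theta>\<^sub>r p' s' r' = \<Theta>\<^sub>r p' s r - (1 / \<gamma>) * (a \<bullet> e) - (1 / \<gamma>) * (b \<bullet> g) - 2 * \<kappa> * (b \<bullet> e) + R"
      unfolding \<Theta>\<^sub>r_def a' R_def \<kappa>_def[symmetric]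
      using gamma_pos
      by (simp add: power2_norm_eq_inner inner_simps inner_commute field_simps)
    have "\<bar>- (d \<bullet> e) + \<gamma> * (h \<bullet> e) - g \<bullet> d + g \<bullet> e\<bar> \<le> \<bar>d \<bullet> e\<bar> + \<bar>\<gamma> * (h \<bullet> e)\<bar> + \<bar>g \<bullet> d\<bar> + \<bar>g \<bullet> e\<bar>"
      by linarith
    also have "\<dots> \<le> N\<^sup>2 + \<gamma> * (\<beta> * N\<^sup>2) + N\<^sup>2 + N\<^sup>2"
      using gamma_pos h by (intro add_mono ip dN eN gN) (auto simp: abs_mult)
    finally have "\<bar>(1 / \<gamma>) * (- (d \<bullet> e) + \<gamma> * (h \<bullet> e) - g \<bullet> d + g \<bullet> e)\<bar> \<le> (1 / \<gamma>) * (N\<^sup>2 + \<gamma> * (\<beta> * N\<^sup>2) + N\<^sup>2 + N\<^sup>2)"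
      unfolding abs_mult using gamma_pos by (intro mult_mono) auto
    moreover have "\<bar>\<kappa> * (- 2 * (d \<bullet> e) + (norm e)\<^sup>2)\<bar> \<le> \<bar>\<kappa>\<bar> * (3 * N\<^sup>2)"
      unfolding abs_mult
    proof (rule mult_left_mono)
      show "\<bar>- 2 * (d \<bullet> e) + (norm e)\<^sup>2\<bar> \<le> 3 * N\<^sup>2"
        using ip[OF dN eN] sq[OF eN] zero_le_power2[of "norm e"] unfolding abs_le_iff by linarith
    qed simp
    ultimately have "\<bar>R\<bar> \<le> (1 / \<gamma>) * (N\<^sup>2 + \<gamma> * (\<beta> * N\<^sup>2) + N\<^sup>2 + N\<^sup>2) + \<bar>\<kappa>\<bar> * (3 * N\<^sup>2)"
      unfolding R_def by linarith
    also have "\<dots> = ((3 + \<gamma> * \<beta>) / \<gamma> + 3 * \<bar>\<kappa>\<bar>) * N\<^sup>2"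
      using gamma_pos by (simp add: field_simps)
    finally have R: "- (((3 + \<gamma> * \<beta>) / \<gamma> + 3 * \<bar>\<kappa>\<bar>) * N\<^sup>2) \<le> R" by linarith
    have "norm (p' - p) < \<rho>" using dN z by (simp add: d_def N_def)
    from \<xi>[OF this] have "\<Theta>\<^sub>r p s r + \<xi> \<bullet> d - c * (norm d)\<^sup>2 \<le> \<Theta>\<^sub>r p' s r" by (simp add: d_def)
    moreover have "c * (norm d)\<^sup>2 \<le> \<bar>c\<bar> * N\<^sup>2" using sq[OF dN] by (intro mult_mono) auto
    ultimately have lower: "\<Theta>\<^sub>r p s r + \<xi> \<bullet> d - (1 / \<gamma>) * (a \<bullet> e) - (1 / \<gamma>) * (b \<bullet> g) - 2 * \<kappa> * (b \<bullet> e)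
        - (\<bar>c\<bar> + (3 + \<gamma> * \<beta>) / \<gamma> + 3 * \<bar>\<kappa>\<bar>) * N\<^sup>2 \<le> \<Theta>\<^sub>r p' s' r'"
      using R unfolding diff distrib_right by linarith
    have ip_eq: "(\<xi>, \<upsilon>, - (1 / \<gamma>) *\<^sub>R b) \<bullet> (z - (p, s, r))
        = \<xi> \<bullet> d + (1 / \<gamma>) * (v \<bullet> e) - (1 / \<gamma>) * (a \<bullet> e) - 2 * \<kappa> * (b \<bullet> e) - (1 / \<gamma>) * (b \<bullet> g)"
      unfolding zd using gamma_pos by (simp add: \<upsilon>_def \<kappa>_def inner_simps field_simps)
    show "\<Theta> (p, s, r) + ereal ((\<xi>, \<upsilon>, - (1 / \<gamma>) *\<^sub>R b) \<bullet> (z - (p, s, r)) - C * (norm (z - (p, s, r)))\<^sup>2) \<le> \<Theta> z"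
    proof (cases "\<phi>2 s'")
      case (real f')
      have "f + (v \<bullet> e - 1 / 2 * (norm e)\<^sup>2) \<le> f'" using v[of s'] by (simp add: f real e_def)
      moreover have "1 / 2 * (norm e)\<^sup>2 \<le> 1 / 2 * N\<^sup>2" using sq[OF eN] by simp
      ultimately have "f + v \<bullet> e - 1 / 2 * N\<^sup>2 \<le> f'" by linarith
      then have "(1 / \<gamma>) * (f + v \<bullet> e - 1 / 2 * N\<^sup>2) \<le> (1 / \<gamma>) * f'"
        using gamma_pos by (intro mult_left_mono) auto
      then have "(1 / \<gamma>) * f + (1 / \<gamma>) * (v \<bullet> e) - 1 / (2 * \<gamma>) * N\<^sup>2 \<le> (1 / \<gamma>) * f'"
        by (simp add: right_diff_distrib distrib_left)
      with lower have "\<Theta>\<^sub>r p s r + (1 / \<gamma>) * f + ((\<xi>, \<upsilon>, - (1 / \<gamma>) *\<^sub>R b) \<bullet> (z - (p, s, r)) - C * N\<^sup>2)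
          \<le> \<Theta>\<^sub>r p' s' r' + (1 / \<gamma>) * f'"
        unfolding ip_eq C_def distrib_right by linarith
      then show ?thesis by (simp add: z_eq Theta_eq f real N_def)
    next
      case PInf
      then show ?thesis using gamma_pos by (simp add: z_eq Theta_eq)
    next
      case MInf
      then show ?thesis using phi2_proper by (simp add: proper_fun_def)
    qed
  qed
  then show ?thesis by (simp add: \<upsilon>_def a_def b_def)
qed

text \<open>The sum of the coefficients of \<epsilon> and of \<open>step k\<close> in the final
  estimate of the next lemma but one, so that it dominates each of them.\<close>

definition C0 :: real where
  "C0 = (L + 6) / \<gamma> + 2 * \<beta> + (1 + L) * (2 / \<gamma> + (5 / \<gamma> + \<beta>) / \<eta>)"

lemma C0_pos: "0 < C0"
proof -
  have "0 < (L + 6) / \<gamma>" using L_nonneg gamma_pos by simp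
  moreover have "0 \<le> (1 + L) * (2 / \<gamma> + (5 / \<gamma> + \<beta>) / \<eta>)"
    using L_nonneg gamma_pos beta_nonneg eta_range by simp
  ultimately show ?thesis using beta_nonneg by (simp add: C0_def)
qed

text \<open>Only the first component is perturbed: \<open>u\<close> and \<open>w\<close> stay exact,
  so the proximal subgradient of \<phi>2 at \<open>u (Suc k)\<close> remains available. All large
  terms cancel through the optimality relations, leaving the residuals \<omega> and \<rho>', both of
  the order of the step, and multiples of \<epsilon>.\<close>

lemma small_subgradient_nearby:
  assumes "0 < \<epsilon>"
  shows "\<exists>p v. norm (p - x (Suc k)) < \<epsilon> \<and> v \<in> regular_subdiff \<Theta> (p, u (Suc k), w (Suc k))
    \<and> norm v \<le> C0 * (step k + \<epsilon>)"
proof -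
  define s r y where "s = u (Suc k)" and "r = w (Suc k)" and "y = x (Suc k)"
  have cont: "continuous_on UNIV (\<lambda>p. \<Theta>\<^sub>r p s r)"
    unfolding continuous_on_def by (auto intro!: Theta_r_tendsto tendsto_ident_at tendsto_const)
  obtain p c \<rho> \<xi> where p: "norm (p - y) < \<epsilon>" and "0 < \<rho>"
    and \<xi>: "\<And>q. norm (q - p) < \<rho> \<Longrightarrow> \<Theta>\<^sub>r p s r + \<xi> \<bullet> (q - p) - c * (norm (q - p))\<^sup>2 \<le> \<Theta>\<^sub>r q s r"
    by (rule proximal_subgradient_nearby[OF cont \<open>0 < \<epsilon>\<close>, of y]) (rule that)
  define e where "e = p - y"
  have pe: "p = y + e" and e: "norm e \<le> \<epsilon>" using p by (simp_all add: e_def)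
  define v where "v = 2 *\<^sub>R y - w k - \<gamma> *\<^sub>R grad \<psi> y - s"
  define \<upsilon> where "\<upsilon> = (1 / \<gamma>) *\<^sub>R (v - (p - r - \<gamma> *\<^sub>R grad \<psi> p) - (1 - 2 * \<eta>) *\<^sub>R (p - s))"
  define \<zeta> where "\<zeta> = - (1 / \<gamma>) *\<^sub>R (p - s)"
  have mem: "(\<xi>, \<upsilon>, \<zeta>) \<in> regular_subdiff \<Theta> (p, s, r)"
    unfolding \<upsilon>_def \<zeta>_def
  proof (rule regular_subgradient_Theta[OF _ _ \<open>0 < \<rho>\<close> \<xi>])
    show "\<bar>\<phi>2 s\<bar> \<noteq> \<infinity>" unfolding s_def by (rule phi2_u_finite)
    fix q show "\<phi>2 s + ereal (v \<bullet> (q - s) - 1 / 2 * (norm (q - s))\<^sup>2) \<le> \<phi>2 q"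
      unfolding v_def s_def y_def by (rule prox_subgradient[OF u_step[rule_format] phi2_proper])
  qed
  define \<omega> \<rho>' where "\<omega> = norm (w k - r)" and "\<rho>' = norm (y - s)"
  define \<sigma> where "\<sigma> = (1 / \<gamma>) *\<^sub>R (grad \<phi>1 p + p - r + (2 - 2 * \<eta>) *\<^sub>R (p - s))"
  have \<omega>: "\<omega> \<le> (1 + L) * step k" using norm_w_diff[of k] by (simp add: \<omega>_def r_def norm_minus_commute)
  have \<rho>': "\<rho>' \<le> (1 + L) / \<eta> * step k" using norm_x_minus_u[of k] by (simp add: \<rho>'_def y_def s_def)
  have ps: "norm (p - s) \<le> \<rho>' + \<epsilon>"
    using norm_triangle_ineq[of "y - s" e] e by (simp add: pe \<rho>'_def algebra_simps)
  have eta: "\<bar>2 - 2 * \<eta>\<bar> \<le> 2" "\<bar>2 * \<eta>\<bar> \<le> 2" using eta_range by auto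
  \<comment> \<open>The size of \<xi> is controlled by squeezing: it minorizes
    \<open>p \<mapsto> \<Theta>\<^sub>r p s r\<close> near \<open>p\<close>, while \<sigma>
    majorizes it up to the Lipschitz error.\<close>
  have "norm (\<xi> - \<sigma>) \<le> \<beta> * norm (p - s)"
  proof -
    obtain C where C: "\<And>p'. \<Theta>\<^sub>r p' s r \<le> \<Theta>\<^sub>r p s r + \<sigma> \<bullet> (p' - p)
      + \<beta> * norm (p - s) * norm (p' - p) + C * (norm (p' - p))\<^sup>2"
      by (rule Theta_r_upper[of s r p, folded \<sigma>_def]) (rule that)
    show ?thesis
    proof (rule subgradient_near_gradient[OF \<open>0 < \<rho>\<close>])
      show "0 \<le> \<beta> * norm (p - s)" using beta_nonneg by simp
      fix q assume "norm (q - p) < \<rho>"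
      from \<xi>[OF this] C[of q]
      show "\<xi> \<bullet> (q - p) - c * (norm (q - p))\<^sup>2 \<le> \<sigma> \<bullet> (q - p) + \<beta> * norm (p - s) * norm (q - p) + C * (norm (q - p))\<^sup>2"
        by linarith
    qed
  qed
  also have "\<beta> * norm (p - s) \<le> \<beta> * (\<rho>' + \<epsilon>)" using ps beta_nonneg by (rule mult_left_mono)
  finally have 1: "norm (\<xi> - \<sigma>) \<le> \<beta> * (\<rho>' + \<epsilon>)" .
  have 2: "norm \<sigma> \<le> (1 / \<gamma>) * (L * \<epsilon> + \<epsilon> + \<omega> + 2 * (\<rho>' + \<epsilon>))"
  proof -
    \<comment> \<open>At the unperturbed point \<open>grad \<phi>1 y + y\<close> is
      \<open>w k\<close>, so only differences remain.\<close>
    have "grad \<phi>1 p + p - r + (2 - 2 * \<eta>) *\<^sub>R (p - s)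
        = (grad \<phi>1 p - grad \<phi>1 y) + e + (w k - r) + (2 - 2 * \<eta>) *\<^sub>R (p - s)"
      by (simp add: w_eq[of k] y_def[symmetric] pe)
    also have "norm \<dots> \<le> L * \<epsilon> + \<epsilon> + \<omega> + 2 * (\<rho>' + \<epsilon>)"
    proof (intro norm_triangle_mono)
      show "norm (grad \<phi>1 p - grad \<phi>1 y) \<le> L * \<epsilon>"
        using grad_phi1_lipschitz[of p y] mult_left_mono[OF e L_nonneg] by (simp add: pe)
      show "norm ((2 - 2 * \<eta>) *\<^sub>R (p - s)) \<le> 2 * (\<rho>' + \<epsilon>)"
        using eta ps by (simp only: norm_scaleR) (intro mult_mono, auto)
    qed (use e in \<open>simp_all add: \<omega>_def\<close>)
    finally show ?thesis
      unfolding \<sigma>_def norm_scaleR using gamma_pos by (intro mult_mono) auto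
  qed
  have 3: "norm \<upsilon> \<le> (1 / \<gamma>) * (2 * \<rho>' + 2 * \<epsilon> + \<omega> + \<gamma> * (\<beta> * \<epsilon>))"
  proof -
    have "v - (p - r - \<gamma> *\<^sub>R grad \<psi> p) - (1 - 2 * \<eta>) *\<^sub>R (p - s)
        = (2 * \<eta>) *\<^sub>R (y - s) + (2 * \<eta> - 2) *\<^sub>R e + (r - w k) + \<gamma> *\<^sub>R (grad \<psi> p - grad \<psi> y)"
      by (simp add: v_def pe algebra_simps scaleR_2)
    also have "norm \<dots> \<le> 2 * \<rho>' + 2 * \<epsilon> + \<omega> + \<gamma> * (\<beta> * \<epsilon>)"
    proof (intro norm_triangle_mono)
      show "norm ((2 * \<eta>) *\<^sub>R (y - s)) \<le> 2 * \<rho>'"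
        using eta unfolding norm_scaleR \<rho>'_def by (intro mult_mono) auto
      show "norm ((2 * \<eta> - 2) *\<^sub>R e) \<le> 2 * \<epsilon>"
        using eta e unfolding norm_scaleR abs_minus_commute[of "2 * \<eta>"] by (intro mult_mono) auto
      show "norm (\<gamma> *\<^sub>R (grad \<psi> p - grad \<psi> y)) \<le> \<gamma> * (\<beta> * \<epsilon>)"
        using grad_psi_lipschitz[of p y] mult_left_mono[OF e beta_nonneg] gamma_pos
        by (simp add: pe)
    qed (simp add: \<omega>_def norm_minus_commute)
    finally show ?thesis
      unfolding \<upsilon>_def norm_scaleR using gamma_pos by (intro mult_mono) auto
  qed
  have 4: "norm \<zeta> \<le> (1 / \<gamma>) * (\<rho>' + \<epsilon>)"
    unfolding \<zeta>_def norm_scaleR using gamma_pos ps by (intro mult_mono) auto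
  have "norm (\<xi>, \<upsilon>, \<zeta>) \<le> norm \<xi> + (norm \<upsilon> + norm \<zeta>)"
    using norm_Pair_le[of \<xi> "(\<upsilon>, \<zeta>)"] norm_Pair_le[of \<upsilon> \<zeta>] by linarith
  also have "norm \<xi> \<le> norm (\<xi> - \<sigma>) + norm \<sigma>"
    using norm_triangle_ineq[of "\<xi> - \<sigma>" \<sigma>] by simp
  finally have "norm (\<xi>, \<upsilon>, \<zeta>) \<le> \<beta> * (\<rho>' + \<epsilon>) + (1 / \<gamma>) * (L * \<epsilon> + \<epsilon> + \<omega> + 2 * (\<rho>' + \<epsilon>))
      + ((1 / \<gamma>) * (2 * \<rho>' + 2 * \<epsilon> + \<omega> + \<gamma> * (\<beta> * \<epsilon>)) + (1 / \<gamma>) * (\<rho>' + \<epsilon>))"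
    using 1 2 3 4 by linarith
  also have "\<dots> = ((L + 6) / \<gamma> + 2 * \<beta>) * \<epsilon> + 2 / \<gamma> * \<omega> + (5 / \<gamma> + \<beta>) * \<rho>'"
    using gamma_pos by (simp add: field_simps)
  also have "\<dots> \<le> ((L + 6) / \<gamma> + 2 * \<beta>) * \<epsilon> + 2 / \<gamma> * ((1 + L) * step k) + (5 / \<gamma> + \<beta>) * ((1 + L) / \<eta> * step k)"
    using \<omega> \<rho>' gamma_pos beta_nonneg by (intro add_mono mult_left_mono order_refl) auto
  also have "\<dots> = ((L + 6) / \<gamma> + 2 * \<beta>) * \<epsilon> + ((1 + L) * (2 / \<gamma> + (5 / \<gamma> + \<beta>) / \<eta>)) * step k"
    by (simp add: algebra_simps add_divide_distrib)
  also have "\<dots> \<le> C0 * \<epsilon> + C0 * step k"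
  proof (intro add_mono mult_right_mono)
    show "(L + 6) / \<gamma> + 2 * \<beta> \<le> C0" "(1 + L) * (2 / \<gamma> + (5 / \<gamma> + \<beta>) / \<eta>) \<le> C0"
      using L_nonneg gamma_pos beta_nonneg eta_range by (simp_all add: C0_def)
  qed (use \<open>0 < \<epsilon>\<close> in \<open>simp_all add: step_nonneg\<close>)
  finally have "norm (\<xi>, \<upsilon>, \<zeta>) \<le> C0 * (step k + \<epsilon>)" by (simp add: distrib_left)
  with mem p show ?thesis unfolding s_def r_def y_def by blast
qed

section \<open>Convergence\<close>

text \<open>Lower semicontinuity gives one inequality; the other comes from testing the minimality
  of \<open>u\<close> against the limit \<open>b\<close> itself. Testing first against any point of
  the domain of \<phi>2 shows that \<open>\<phi>2 b\<close> is finite.\<close>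

lemma phi2_val_tendsto:
  assumes X: "(\<lambda>j. x (Suc (r j))) \<longlonglongrightarrow> a" and U: "(\<lambda>j. u (Suc (r j))) \<longlonglongrightarrow> b"
  shows "\<exists>f. \<phi>2 b = ereal f \<and> (\<lambda>j. phi2_val (r j)) \<longlonglongrightarrow> f"
proof -
  define Q where "Q j = 2 *\<^sub>R x (Suc (r j)) - w (r j) - \<gamma> *\<^sub>R grad \<psi> (x (Suc (r j)))" for j
  define q where "q = 2 *\<^sub>R a - (a + grad \<phi>1 a) - \<gamma> *\<^sub>R grad \<psi> a"
  have Q: "Q \<longlonglongrightarrow> q"
    unfolding Q_def q_def w_eq by (intro tendsto_intros data_tendsto X)
  have bound: "phi2_val (r j) \<le> c + 1 / 2 * (norm (p - Q j))\<^sup>2 - 1 / 2 * (norm (u (Suc (r j)) - Q j))\<^sup>2"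
    if "\<phi>2 p = ereal c" for p c j
    using prox_le[OF u_step[rule_format, of "r j"] phi2_proper, of p] that
    by (simp add: phi2_u Q_def)
  have lim: "(\<lambda>j. c + 1 / 2 * (norm (p - Q j))\<^sup>2 - 1 / 2 * (norm (u (Suc (r j)) - Q j))\<^sup>2)
      \<longlonglongrightarrow> c + 1 / 2 * (norm (p - q))\<^sup>2 - 1 / 2 * (norm (b - q))\<^sup>2" for p c
    by (intro tendsto_intros Q U)
  have lower: "\<forall>\<^sub>F j in sequentially. y < phi2_val (r j)" if "ereal y < \<phi>2 b" for y
  proof -
    have "\<forall>\<^sub>F j in sequentially. ereal y < \<phi>2 (u (Suc (r j)))"
      using closed_fun_eventually_less[OF phi2_closed that] U by (rule eventually_compose_filterlim)
    then show ?thesis by (simp add: phi2_u)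
  qed
  obtain p c where p: "\<phi>2 p = ereal c"
  proof -
    obtain p where "\<phi>2 p \<noteq> \<infinity>" "\<phi>2 p \<noteq> -\<infinity>" using phi2_proper by (auto simp: proper_fun_def)
    then show ?thesis by (cases "\<phi>2 p") (auto intro: that)
  qed
  have "\<phi>2 b \<noteq> \<infinity>"
  proof
    define M where "M = c + 1 / 2 * (norm (p - q))\<^sup>2 - 1 / 2 * (norm (b - q))\<^sup>2 + 1"
    assume "\<phi>2 b = \<infinity>"
    then have "\<forall>\<^sub>F j in sequentially. M < phi2_val (r j)" by (intro lower) simp
    moreover have "\<forall>\<^sub>F j in sequentially.
        c + 1 / 2 * (norm (p - Q j))\<^sup>2 - 1 / 2 * (norm (u (Suc (r j)) - Q j))\<^sup>2 < M"
      by (rule order_tendstoD(2)[OF lim]) (simp add: M_def)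
    ultimately have "\<forall>\<^sub>F j in sequentially. False"
    proof eventually_elim
      case (elim j)
      with bound[OF p, of j] show False by linarith
    qed
    then show False by simp
  qed
  moreover have "\<phi>2 b \<noteq> -\<infinity>" using phi2_proper by (simp add: proper_fun_def)
  ultimately obtain f where f: "\<phi>2 b = ereal f" by (cases "\<phi>2 b") auto
  have "(\<lambda>j. phi2_val (r j)) \<longlonglongrightarrow> f"
  proof (rule order_tendstoI)
    fix y assume "y < f"
    then show "\<forall>\<^sub>F j in sequentially. y < phi2_val (r j)" by (intro lower) (simp add: f)
  next
    fix y assume "f < y"
    then have "\<forall>\<^sub>F j in sequentially.
        f + 1 / 2 * (norm (b - Q j))\<^sup>2 - 1 / 2 * (norm (u (Suc (r j)) - Q j))\<^sup>2 < y"
      by (intro order_tendstoD(2)[OF lim]) simp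
    then show "\<forall>\<^sub>F j in sequentially. phi2_val (r j) < y"
    proof eventually_elim
      case (elim j)
      with bound[OF f, of j] show ?case by linarith
    qed
  qed
  with f show ?thesis by blast
qed

section \<open>Cluster points of the iterates\<close>

lemma decseq_T: "decseq T"
proof (rule decseq_SucI)
  fix k
  have "0 \<le> Lambda \<beta> l L \<gamma> \<eta> * (step k)\<^sup>2" using Lambda_pos by simp
  with descent[of k] show "T (Suc k) \<le> T k" by linarith
qed

text \<open>The limit along the subsequence bounds the decreasing \<open>T\<close> from below, so
  all of \<open>T\<close> converges to it and the steps vanish. Then \<open>x - u\<close> and the
  increments of \<open>w\<close> vanish too, which forces the cluster triple to have the form
  \<open>(a, a, a + grad \<phi>1 a)\<close>.\<close>

lemma convergent_subsequence:
  assumes "bounded (range (\<lambda>k. (x k, u k, w k)))"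
  obtains r a f where "strict_mono r" "(\<lambda>j. x (Suc (r j))) \<longlonglongrightarrow> a" "(\<lambda>j. u (Suc (r j))) \<longlonglongrightarrow> a"
    "(\<lambda>j. w (Suc (r j))) \<longlonglongrightarrow> a + grad \<phi>1 a" "\<phi>2 a = ereal f" "(\<lambda>j. phi2_val (r j)) \<longlonglongrightarrow> f"
    "T \<longlonglongrightarrow> \<Theta>\<^sub>r a a (a + grad \<phi>1 a) + f / \<gamma>" "step \<longlonglongrightarrow> 0"
proof -
  have "bounded (range (\<lambda>k. (x (Suc k), u (Suc k), w (Suc k))))"
    by (rule bounded_subset[OF assms]) auto
  from bounded_imp_convergent_subsequence[OF this]
  obtain z r where r: "strict_mono r" and z: "((\<lambda>k. (x (Suc k), u (Suc k), w (Suc k))) \<circ> r) \<longlonglongrightarrow> z"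
    by blast
  obtain a b c where z_eq: "z = (a, b, c)" by (cases z)
  have lim: "(\<lambda>j. x (Suc (r j))) \<longlonglongrightarrow> a" "(\<lambda>j. u (Suc (r j))) \<longlonglongrightarrow> b" "(\<lambda>j. w (Suc (r j))) \<longlonglongrightarrow> c"
    using tendsto_fst[OF z] tendsto_fst[OF tendsto_snd[OF z]] tendsto_snd[OF tendsto_snd[OF z]]
    by (simp_all add: z_eq comp_def)
  obtain f where f: "\<phi>2 b = ereal f" "(\<lambda>j. phi2_val (r j)) \<longlonglongrightarrow> f"
    using phi2_val_tendsto[OF lim(1,2)] by blast
  define T0 where "T0 = \<Theta>\<^sub>r a b c + f / \<gamma>"
  have Tr: "(\<lambda>j. T (r j)) \<longlonglongrightarrow> T0"
    unfolding T_def T0_def using gamma_pos by (intro tendsto_intros Theta_r_tendsto lim f) auto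
  have "decseq (\<lambda>j. T (r j))"
    using decseq_T strict_mono_mono[OF r] by (simp add: decseq_def mono_def)
  from decseq_ge[OF this Tr] have "T0 \<le> T (r j)" for j .
  then have "T0 \<le> T j" for j
    using decseqD[OF decseq_T seq_suble[OF r, of j]] by (meson order_trans)
  then obtain T1 where T1: "T \<longlonglongrightarrow> T1" using decseq_convergent[OF decseq_T, of T0] by blast
  have "T1 = T0"
    using LIMSEQ_subseq_LIMSEQ[OF T1 r] Tr by (auto simp: comp_def intro: LIMSEQ_unique)
  with T1 have T: "T \<longlonglongrightarrow> T0" by simp
  have step: "step \<longlonglongrightarrow> 0"
    by (rule sufficient_descent_vanishing[OF descent Lambda_pos T])
  have stepr: "(\<lambda>j. step (r j)) \<longlonglongrightarrow> 0"
    using LIMSEQ_subseq_LIMSEQ[OF step r] by (simp add: comp_def)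
  have "(\<lambda>j. x (Suc (r j)) - u (Suc (r j))) \<longlonglongrightarrow> 0"
    by (rule Lim_null_comparison[OF always_eventually tendsto_mult_right_zero[OF stepr, of "(1 + L) / \<eta>"]])
      (intro allI norm_x_minus_u)
  with tendsto_diff[OF lim(1,2)] have "a - b = 0" by (metis LIMSEQ_unique)
  then have b: "b = a" by simp
  have "(\<lambda>j. w (Suc (r j)) - w (r j)) \<longlonglongrightarrow> 0"
    by (rule Lim_null_comparison[OF always_eventually tendsto_mult_right_zero[OF stepr, of "1 + L"]])
      (intro allI norm_w_diff)
  moreover have "(\<lambda>j. w (Suc (r j)) - w (r j)) \<longlonglongrightarrow> c - (a + grad \<phi>1 a)"
    unfolding w_eq[of "r _"] by (intro tendsto_intros data_tendsto lim)
  ultimately have "c - (a + grad \<phi>1 a) = 0" by (metis LIMSEQ_unique)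
  then have c: "c = a + grad \<phi>1 a" by simp
  show ?thesis
    using that[OF r lim(1) lim(2,3)[unfolded b c] f[unfolded b] T[unfolded T0_def b c] step] .
qed

text \<open>Needed to invoke the KL property, which is granted only where the limiting
  subdifferential is nonempty.\<close>

lemma zero_in_limiting_subdiff_Theta:
  assumes r: "strict_mono r" and lim: "(\<lambda>j. x (Suc (r j))) \<longlonglongrightarrow> a" "(\<lambda>j. u (Suc (r j))) \<longlonglongrightarrow> b"
      "(\<lambda>j. w (Suc (r j))) \<longlonglongrightarrow> c" and f: "\<phi>2 b = ereal f" "(\<lambda>j. phi2_val (r j)) \<longlonglongrightarrow> f"
    and step: "step \<longlonglongrightarrow> 0"
  shows "0 \<in> limiting_subdiff \<Theta> (a, b, c)"
proof -
  define \<epsilon> where "\<epsilon> j = 1 / (real j + 1)" for j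
  have \<epsilon>: "\<epsilon> \<longlonglongrightarrow> 0" "0 < \<epsilon> j" for j
    unfolding \<epsilon>_def using LIMSEQ_inverse_real_of_nat by (auto simp: inverse_eq_divide add.commute)
  have "\<forall>j. \<exists>p v. norm (p - x (Suc (r j))) < \<epsilon> j \<and> v \<in> regular_subdiff \<Theta> (p, u (Suc (r j)), w (Suc (r j)))
    \<and> norm v \<le> C0 * (step (r j) + \<epsilon> j)"
    using small_subgradient_nearby[OF \<epsilon>(2)] by blast
  then obtain p v where p: "\<And>j. norm (p j - x (Suc (r j))) < \<epsilon> j"
    and v: "\<And>j. v j \<in> regular_subdiff \<Theta> (p j, u (Suc (r j)), w (Suc (r j)))"
    and v_le: "\<And>j. norm (v j) \<le> C0 * (step (r j) + \<epsilon> j)"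
    by metis
  have "(\<lambda>j. p j - x (Suc (r j))) \<longlonglongrightarrow> 0"
    by (rule Lim_null_comparison[OF always_eventually \<epsilon>(1)]) (use p less_imp_le in blast)
  from tendsto_add[OF this lim(1)] have p_lim: "p \<longlonglongrightarrow> a" by simp
  have "(\<lambda>j. step (r j)) \<longlonglongrightarrow> 0"
    using LIMSEQ_subseq_LIMSEQ[OF step r] by (simp add: comp_def)
  from tendsto_add[OF this \<epsilon>(1)] have "(\<lambda>j. C0 * (step (r j) + \<epsilon> j)) \<longlonglongrightarrow> 0"
    by (intro tendsto_mult_right_zero) simp
  then have v_lim: "v \<longlonglongrightarrow> 0"
    by (rule Lim_null_comparison[OF always_eventually[OF allI[OF v_le]]])
  have "(\<lambda>j. \<Theta>\<^sub>r (p j) (u (Suc (r j))) (w (Suc (r j))) + (1 / \<gamma>) * phi2_val (r j)) \<longlonglongrightarrow> \<Theta>\<^sub>r a b c + (1 / \<gamma>) * f"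
    by (intro tendsto_intros Theta_r_tendsto p_lim lim f)
  then have "(\<lambda>j. \<Theta> (p j, u (Suc (r j)), w (Suc (r j)))) \<longlonglongrightarrow> \<Theta> (a, b, c)"
    by (simp add: Theta_eq phi2_u f)
  moreover have "(\<lambda>j. (p j, u (Suc (r j)), w (Suc (r j)))) \<longlonglongrightarrow> (a, b, c)"
    by (intro tendsto_Pair p_lim lim)
  moreover have "\<bar>\<Theta> (a, b, c)\<bar> \<noteq> \<infinity>" by (simp add: Theta_eq f)
  ultimately show ?thesis
    unfolding limiting_subdiff_def
    by (intro CollectI conjI exI[of _ "\<lambda>j. (p j, u (Suc (r j)), w (Suc (r j)))"] exI[of _ v] allI v v_lim)
qed

text \<open>The triple is governed by \<open>x\<close> and the step alone, so finite length can be
  proved for \<open>x\<close> although KL lives in the product space.\<close>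

lemma iterates_near:
  "norm ((x (Suc k), u (Suc k), w (Suc k)) - (a, a, a + grad \<phi>1 a))
    \<le> (3 + L) * norm (x (Suc k) - a) + (1 + L) * (1 + 1 / \<eta>) * step k"
proof -
  have "norm (u (Suc k) - a) \<le> norm (x (Suc k) - a) + (1 + L) / \<eta> * step k"
    using norm_triangle_ineq[of "x (Suc k) - a" "u (Suc k) - x (Suc k)"] norm_x_minus_u[of k]
    by (simp add: norm_minus_commute)
  moreover have "norm (w (Suc k) - (a + grad \<phi>1 a)) \<le> norm (x (Suc k) - a) + L * norm (x (Suc k) - a) + (1 + L) * step k"
  proof -
    have "w (Suc k) - (a + grad \<phi>1 a)
        = (x (Suc k) - a) + (grad \<phi>1 (x (Suc k)) - grad \<phi>1 a) + (w (Suc k) - w k)"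
      by (simp add: w_eq[of k])
    also have "norm \<dots> \<le> norm (x (Suc k) - a) + L * norm (x (Suc k) - a) + (1 + L) * step k"
      by (intro norm_triangle_mono grad_phi1_lipschitz norm_w_diff order_refl)
    finally show ?thesis .
  qed
  moreover have "norm ((x (Suc k), u (Suc k), w (Suc k)) - (a, a, a + grad \<phi>1 a))
      \<le> norm (x (Suc k) - a) + (norm (u (Suc k) - a) + norm (w (Suc k) - (a + grad \<phi>1 a)))"
    using norm_Pair_le[of "x (Suc k) - a" "(u (Suc k) - a, w (Suc k) - (a + grad \<phi>1 a))"]
      norm_Pair_le[of "u (Suc k) - a" "w (Suc k) - (a + grad \<phi>1 a)"] by simp
  ultimately show ?thesis by (simp add: algebra_simps)
qed

text \<open>The subgradients produced above live at perturbed points, so the KL inequality is applied there and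
  then passed to the limit, using the continuity of \<open>\<Psi>'\<close>.\<close>

lemma KL_at_iterate:
  assumes V: "open V" "(x (Suc k), u (Suc k), w (Suc k)) \<in> V"
    and \<Psi>': "\<forall>t\<in>{0<..<\<delta>}. 0 < \<Psi>' t" "continuous_on {0<..<\<delta>} \<Psi>'"
    and KL: "\<And>z. z \<in> V \<Longrightarrow> ereal T0 < \<Theta> z \<Longrightarrow> \<Theta> z < ereal T0 + ereal \<delta> \<Longrightarrow>
      1 \<le> ereal (\<Psi>' (real_of_ereal (\<Theta> z - ereal T0))) * dist_zero (limiting_subdiff \<Theta> z)"
    and T: "T0 < T k" "T k < T0 + \<delta>"
  shows "1 \<le> \<Psi>' (T k - T0) * (C0 * step k)"
proof -
  define \<epsilon> where "\<epsilon> j = 1 / (real j + 1)" for j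
  have \<epsilon>: "\<epsilon> \<longlonglongrightarrow> 0" "0 < \<epsilon> j" for j
    unfolding \<epsilon>_def using LIMSEQ_inverse_real_of_nat by (auto simp: inverse_eq_divide add.commute)
  have "\<forall>j. \<exists>p v. norm (p - x (Suc k)) < \<epsilon> j \<and> v \<in> regular_subdiff \<Theta> (p, u (Suc k), w (Suc k))
    \<and> norm v \<le> C0 * (step k + \<epsilon> j)"
    using small_subgradient_nearby[OF \<epsilon>(2)] by blast
  then obtain p v where p: "\<And>j. norm (p j - x (Suc k)) < \<epsilon> j"
    and v: "\<And>j. v j \<in> regular_subdiff \<Theta> (p j, u (Suc k), w (Suc k))"
    and v_le: "\<And>j. norm (v j) \<le> C0 * (step k + \<epsilon> j)"
    by metis
  have "(\<lambda>j. p j - x (Suc k)) \<longlonglongrightarrow> 0"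
    by (rule Lim_null_comparison[OF always_eventually \<epsilon>(1)]) (use p less_imp_le in blast)
  from tendsto_add[OF this tendsto_const[of "x (Suc k)"]] have p_lim: "p \<longlonglongrightarrow> x (Suc k)" by simp
  define \<tau> where "\<tau> j = \<Theta>\<^sub>r (p j) (u (Suc k)) (w (Suc k)) + phi2_val k / \<gamma>" for j
  have \<tau>: "\<Theta> (p j, u (Suc k), w (Suc k)) = ereal (\<tau> j)" for j
    by (simp add: Theta_eq phi2_u \<tau>_def)
  have \<tau>_lim: "\<tau> \<longlonglongrightarrow> T k"
    unfolding \<tau>_def T_def by (intro tendsto_add tendsto_const Theta_r_tendsto p_lim)
  have "(\<lambda>j. (p j, u (Suc k), w (Suc k))) \<longlonglongrightarrow> (x (Suc k), u (Suc k), w (Suc k))"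
    by (intro tendsto_Pair p_lim tendsto_const)
  from topological_tendstoD[OF this V] have "\<forall>\<^sub>F j in sequentially. (p j, u (Suc k), w (Suc k)) \<in> V" .
  moreover have "\<forall>\<^sub>F j in sequentially. T0 < \<tau> j" "\<forall>\<^sub>F j in sequentially. \<tau> j < T0 + \<delta>"
    using order_tendstoD[OF \<tau>_lim] T by auto
  ultimately have "\<forall>\<^sub>F j in sequentially. 1 \<le> \<Psi>' (\<tau> j - T0) * (C0 * (step k + \<epsilon> j)) \<and> \<tau> j - T0 \<in> {0<..<\<delta>}"
  proof eventually_elim
    case (elim j)
    have mem: "\<tau> j - T0 \<in> {0<..<\<delta>}" using elim by auto
    then have pos: "0 < \<Psi>' (\<tau> j - T0)" using \<Psi>'(1) by blast
    have "dist_zero (limiting_subdiff \<Theta> (p j, u (Suc k), w (Suc k))) \<le> ereal (norm (v j))"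
      unfolding dist_zero_def by (rule INF_lower) (rule regular_subdiff_imp_limiting[OF v])
    then have "ereal (\<Psi>' (\<tau> j - T0)) * dist_zero (limiting_subdiff \<Theta> (p j, u (Suc k), w (Suc k)))
        \<le> ereal (\<Psi>' (\<tau> j - T0)) * ereal (norm (v j))"
      using pos by (intro ereal_mult_left_mono) auto
    moreover have "1 \<le> ereal (\<Psi>' (\<tau> j - T0)) * dist_zero (limiting_subdiff \<Theta> (p j, u (Suc k), w (Suc k)))"
      using KL[OF elim(1)] elim(2,3) by (simp add: \<tau>)
    ultimately have "1 \<le> ereal (\<Psi>' (\<tau> j - T0)) * ereal (norm (v j))" by (rule order_trans[rotated])
    then have "1 \<le> \<Psi>' (\<tau> j - T0) * norm (v j)" by simp
    also have "\<dots> \<le> \<Psi>' (\<tau> j - T0) * (C0 * (step k + \<epsilon> j))"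
      using pos v_le by (intro mult_left_mono) auto
    finally show ?case using mem by blast
  qed
  then have ev: "\<forall>\<^sub>F j in sequentially. 1 \<le> \<Psi>' (\<tau> j - T0) * (C0 * (step k + \<epsilon> j))"
    and ev': "\<forall>\<^sub>F j in sequentially. \<tau> j - T0 \<in> {0<..<\<delta>}"
    by (auto elim: eventually_mono)
  have "(\<lambda>j. \<tau> j - T0) \<longlonglongrightarrow> T k - T0" by (intro tendsto_intros \<tau>_lim)
  then have "(\<lambda>j. \<Psi>' (\<tau> j - T0)) \<longlonglongrightarrow> \<Psi>' (T k - T0)"
    by (rule continuous_on_tendsto_compose[OF \<Psi>'(2) _ _ ev']) (use T in simp)
  then have "(\<lambda>j. \<Psi>' (\<tau> j - T0) * (C0 * (step k + \<epsilon> j))) \<longlonglongrightarrow> \<Psi>' (T k - T0) * (C0 * (step k + 0))"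
    by (intro tendsto_intros \<epsilon>(1))
  from tendsto_lowerbound[OF this ev] show ?thesis by simp
qed

lemma summable_step:
  assumes bdd: "bounded (range (\<lambda>k. (x k, u k, w k)))" and KL: "KL_function \<Theta>"
  shows "summable step"
proof -
  obtain r a f where r: "strict_mono r" and X: "(\<lambda>j. x (Suc (r j))) \<longlonglongrightarrow> a" and U: "(\<lambda>j. u (Suc (r j))) \<longlonglongrightarrow> a"
    and W: "(\<lambda>j. w (Suc (r j))) \<longlonglongrightarrow> a + grad \<phi>1 a" and f: "\<phi>2 a = ereal f" "(\<lambda>j. phi2_val (r j)) \<longlonglongrightarrow> f"
    and T: "T \<longlonglongrightarrow> \<Theta>\<^sub>r a a (a + grad \<phi>1 a) + f / \<gamma>" and step: "step \<longlonglongrightarrow> 0"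
    by (rule convergent_subsequence[OF bdd])
  define z where "z = (a, a, a + grad \<phi>1 a)"
  define T0 where "T0 = \<Theta>\<^sub>r a a (a + grad \<phi>1 a) + f / \<gamma>"
  have z: "\<Theta> z = ereal T0" by (simp add: z_def Theta_eq f T0_def)
  have "limiting_subdiff \<Theta> z \<noteq> {}"
    using zero_in_limiting_subdiff_Theta[OF r X U W f step] unfolding z_def by blast
  with KL have "KL_property_at \<Theta> z" unfolding KL_function_def by blast
  then obtain V \<delta> \<Psi> \<Psi>' where V: "z \<in> interior V" and \<delta>: "0 < \<delta>"
    and \<Psi>: "\<forall>t\<in>{0..<\<delta>}. 0 \<le> \<Psi> t" "\<Psi> 0 = 0" "concave_on {0..<\<delta>} \<Psi>" "continuous_on {0..<\<delta>} \<Psi>"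
    and d\<Psi>: "\<forall>t\<in>{0<..<\<delta>}. (\<Psi> has_real_derivative \<Psi>' t) (at t) \<and> 0 < \<Psi>' t"
    and \<Psi>': "continuous_on {0<..<\<delta>} \<Psi>'"
    and ineq: "\<forall>x\<in>V. \<Theta> z < \<Theta> x \<and> \<Theta> x < \<Theta> z + ereal \<delta> \<longrightarrow>
          1 \<le> ereal (\<Psi>' (real_of_ereal (\<Theta> x - \<Theta> z))) * dist_zero (limiting_subdiff \<Theta> x)"
    unfolding KL_property_at_def by blast
  obtain e where e: "0 < e" "ball z e \<subseteq> interior V"
    using V open_contains_ball[of "interior V"] by auto
  \<comment> \<open>The sum of the two coefficients in \<open>iterates_near\<close>: if the distance
    and the step are both below \<open>e / B\<close>, the triple lies in the ball of radius
    \<open>e\<close>.\<close>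
  define B where "B = (3 + L) + (1 + L) * (1 + 1 / \<eta>)"
  have B: "0 < B" unfolding B_def using L_nonneg eta_range by (intro add_pos_nonneg) auto
  have "summable (\<lambda>k. norm (x (Suc (Suc k)) - x (Suc k)))"
  proof (rule KL_finite_length[where X = "\<lambda>k. x (Suc k)" and T = T and \<tau> = T0 and r = r and z = a
        and a = "Lambda \<beta> l L \<gamma> \<eta>" and \<delta> = \<delta> and \<Psi> = \<Psi> and \<Psi>' = \<Psi>' and C = C0 and \<rho> = "e / B"])
    show "T (Suc k) \<le> T k - Lambda \<beta> l L \<gamma> \<eta> * (norm (x (Suc (Suc k)) - x (Suc k)))\<^sup>2" for k
      using descent[of k] by (simp add: step_def)
    show "0 < Lambda \<beta> l L \<gamma> \<eta>" by (rule Lambda_pos)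
    show "T \<longlonglongrightarrow> T0" using T by (simp add: T0_def)
    show "strict_mono r" by (fact r)
    show "((\<lambda>k. x (Suc k)) \<circ> r) \<longlonglongrightarrow> a" using X by (simp add: comp_def)
    show "0 < \<delta>" "0 < e / B" "0 < C0" using \<delta> e B C0_pos by simp_all
    show "\<forall>t\<in>{0<..<\<delta>}. (\<Psi> has_real_derivative \<Psi>' t) (at t)" using d\<Psi> by blast
    fix k
    assume k: "norm (x (Suc k) - a) < e / B" "norm (x (Suc (Suc k)) - x (Suc k)) < e / B"
      and Tk: "T0 < T k" "T k < T0 + \<delta>"
    show "1 \<le> \<Psi>' (T k - T0) * (C0 * norm (x (Suc (Suc k)) - x (Suc k)))"
      unfolding step_def[symmetric]
    proof (rule KL_at_iterate[OF open_interior _ _ \<Psi>' _ Tk])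
      have "norm ((x (Suc k), u (Suc k), w (Suc k)) - z)
          \<le> (3 + L) * norm (x (Suc k) - a) + (1 + L) * (1 + 1 / \<eta>) * step k"
        unfolding z_def by (rule iterates_near)
      also have "\<dots> < (3 + L) * (e / B) + (1 + L) * (1 + 1 / \<eta>) * (e / B)"
        using k L_nonneg eta_range
        by (intro add_less_le_mono mult_strict_left_mono mult_left_mono) (auto simp: step_def)
      also have "\<dots> = B * (e / B)" by (simp only: B_def distrib_right)
      also have "\<dots> = e" using B by simp
      finally show "(x (Suc k), u (Suc k), w (Suc k)) \<in> interior V"
        using e(2) by (auto simp: dist_norm norm_minus_commute)
      show "\<forall>t\<in>{0<..<\<delta>}. 0 < \<Psi>' t" using d\<Psi> by blast
      fix z' assume "z' \<in> interior V" "ereal T0 < \<Theta> z'" "\<Theta> z' < ereal T0 + ereal \<delta>"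
      with ineq interior_subset[of V] show "1 \<le> ereal (\<Psi>' (real_of_ereal (\<Theta> z' - ereal T0))) * dist_zero (limiting_subdiff \<Theta> z')"
        unfolding z by blast
    qed
  qed (fact \<Psi>)+
  then show ?thesis by (simp add: step_def[abs_def])
qed

section \<open>Criticality of the limit for the objective\<close>

lemma regular_subgradient_objective:
  assumes fin: "\<bar>\<phi>2 s\<bar> \<noteq> \<infinity>"
    and v: "\<And>q. \<phi>2 s + ereal (v \<bullet> (q - s) - 1 / 2 * (norm (q - s))\<^sup>2) \<le> \<phi>2 q"
  shows "grad \<psi> s + (1 / \<gamma>) *\<^sub>R grad \<phi>1 s + (1 / \<gamma>) *\<^sub>R v
    \<in> regular_subdiff (\<lambda>p. ereal (\<psi> p) + ereal (1 / \<gamma> * \<phi>1 p) + ereal (1 / \<gamma>) * \<phi>2 p) s"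
    (is "?g \<in> regular_subdiff ?F s")
proof -
  obtain f where f: "\<phi>2 s = ereal f" using fin by (cases "\<phi>2 s") auto
  show ?thesis
  proof (rule regular_subdiffI[of _ _ 1 _ "\<beta> / 2 + (1 / \<gamma>) * (L / 2) + (1 / \<gamma>) * (1 / 2)"])
    show "\<bar>?F s\<bar> \<noteq> \<infinity>" by (simp add: f)
    fix q
    define d where "d = q - s"
    show "?F s + ereal (?g \<bullet> (q - s) - (\<beta> / 2 + (1 / \<gamma>) * (L / 2) + (1 / \<gamma>) * (1 / 2)) * (norm (q - s))\<^sup>2) \<le> ?F q"
    proof (cases "\<phi>2 q")
      case (real g)
      have 1: "\<psi> s + grad \<psi> s \<bullet> d - \<beta> / 2 * (norm d)\<^sup>2 \<le> \<psi> q"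
        using psi_bounds[of q s] unfolding d_def abs_le_iff by linarith
      have "\<phi>1 s + grad \<phi>1 s \<bullet> d - L / 2 * (norm d)\<^sup>2 \<le> \<phi>1 q"
        using phi1_bounds[of q s] unfolding d_def abs_le_iff by linarith
      then have 2: "(1 / \<gamma>) * (\<phi>1 s + grad \<phi>1 s \<bullet> d - L / 2 * (norm d)\<^sup>2) \<le> (1 / \<gamma>) * \<phi>1 q"
        using gamma_pos by (intro mult_left_mono) auto
      have "f + (v \<bullet> d - 1 / 2 * (norm d)\<^sup>2) \<le> g" using v[of q] by (simp add: f real d_def)
      then have 3: "(1 / \<gamma>) * (f + (v \<bullet> d - 1 / 2 * (norm d)\<^sup>2)) \<le> (1 / \<gamma>) * g"
        using gamma_pos by (intro mult_left_mono) auto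
      have "\<psi> s + (1 / \<gamma>) * \<phi>1 s + (1 / \<gamma>) * f + (?g \<bullet> d - (\<beta> / 2 + (1 / \<gamma>) * (L / 2) + (1 / \<gamma>) * (1 / 2)) * (norm d)\<^sup>2)
          \<le> \<psi> q + (1 / \<gamma>) * \<phi>1 q + (1 / \<gamma>) * g"
        using 1 2 3 unfolding inner_add_left inner_scaleR_left distrib_left distrib_right right_diff_distrib
        by linarith
      then show ?thesis by (simp add: f real d_def)
    qed (use gamma_pos phi2_proper in \<open>simp_all add: proper_fun_def\<close>)
  qed simp
qed

text \<open>Subgradients are taken at \<open>u\<close>, where \<phi>2 is finite and its proximal
  subgradient is known; at \<open>x\<close> neither is guaranteed. In the limit the residual of the
  u-step cancels both gradients.\<close>

lemma critical_limit:
  assumes X: "(\<lambda>k. x (Suc k)) \<longlonglongrightarrow> a" and U: "(\<lambda>k. u (Suc k)) \<longlonglongrightarrow> a"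
  shows "0 \<in> limiting_subdiff (\<lambda>p. ereal (\<psi> p) + ereal (1 / \<gamma> * \<phi>1 p) + ereal (1 / \<gamma>) * \<phi>2 p) a"
    (is "0 \<in> limiting_subdiff ?F a")
proof -
  obtain f where f: "\<phi>2 a = ereal f" "phi2_val \<longlonglongrightarrow> f"
    using phi2_val_tendsto[where r = "\<lambda>k. k", OF X U] by auto
  define q where "q k = 2 *\<^sub>R x (Suc k) - w k - \<gamma> *\<^sub>R grad \<psi> (x (Suc k))" for k
  define v where "v k = grad \<psi> (u (Suc k)) + (1 / \<gamma>) *\<^sub>R grad \<phi>1 (u (Suc k)) + (1 / \<gamma>) *\<^sub>R (q k - u (Suc k))" for k
  have v: "v k \<in> regular_subdiff ?F (u (Suc k))" for k
    unfolding v_def q_def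
    by (rule regular_subgradient_objective[OF phi2_u_finite prox_subgradient[OF u_step[rule_format] phi2_proper]])
  have "v \<longlonglongrightarrow> grad \<psi> a + (1 / \<gamma>) *\<^sub>R grad \<phi>1 a + (1 / \<gamma>) *\<^sub>R (2 *\<^sub>R a - (a + grad \<phi>1 a) - \<gamma> *\<^sub>R grad \<psi> a - a)"
    unfolding v_def q_def w_eq by (intro tendsto_intros data_tendsto X U)
  moreover have "grad \<psi> a + (1 / \<gamma>) *\<^sub>R grad \<phi>1 a + (1 / \<gamma>) *\<^sub>R (2 *\<^sub>R a - (a + grad \<phi>1 a) - \<gamma> *\<^sub>R grad \<psi> a - a) = 0"
    using gamma_pos by (simp add: algebra_simps scaleR_2)
  ultimately have "v \<longlonglongrightarrow> 0" by simp
  moreover have "(\<lambda>k. \<psi> (u (Suc k)) + 1 / \<gamma> * \<phi>1 (u (Suc k)) + 1 / \<gamma> * phi2_val k) \<longlonglongrightarrow> \<psi> a + 1 / \<gamma> * \<phi>1 a + 1 / \<gamma> * f"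
    by (intro tendsto_intros data_tendsto U f)
  then have "(\<lambda>k. ?F (u (Suc k))) \<longlonglongrightarrow> ?F a" by (simp add: phi2_u f)
  moreover have "\<bar>?F a\<bar> \<noteq> \<infinity>" by (simp add: f)
  ultimately show ?thesis
    unfolding limiting_subdiff_def using U v by blast
qed

lemma finite_length_and_critical_limit:
  assumes "bounded (range (\<lambda>k. (x k, u k, w k)))" and "KL_function \<Theta>"
  shows "summable (\<lambda>k. norm (x (Suc k) - x k))" "summable (\<lambda>k. norm (u (Suc k) - u k))"
    "summable (\<lambda>k. norm (w (Suc k) - w k))"
    "\<exists>a. x \<longlonglongrightarrow> a \<and> u \<longlonglongrightarrow> a \<and>
      0 \<in> limiting_subdiff (\<lambda>p. ereal (\<psi> p) + ereal (1 / \<gamma> * \<phi>1 p) + ereal (1 / \<gamma>) * \<phi>2 p) a"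
proof -
  have S: "summable step" by (rule summable_step[OF assms])
  then show sx: "summable (\<lambda>k. norm (x (Suc k) - x k))"
    unfolding step_def[abs_def] by (rule iffD1[OF summable_Suc_iff[of "\<lambda>k. norm (x (Suc k) - x k)"]])
  show sw: "summable (\<lambda>k. norm (w (Suc k) - w k))"
    by (rule summable_comparison_test'[OF summable_mult[OF S, of "1 + L"], of 0]) (simp add: norm_w_diff)
  have "norm (u (Suc (Suc k)) - u (Suc k))
      \<le> step k + ((1 / \<eta>) * norm (w (Suc (Suc k)) - w (Suc k)) + (1 / \<eta>) * norm (w (Suc k) - w k))" for k
  proof -
    \<comment> \<open>The update of \<open>w\<close>, solved for \<open>u\<close>, expresses an
      increment of \<open>u\<close> by one increment of \<open>x\<close> and two of
      \<open>w\<close>.\<close>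
    have "u (Suc k) = x (Suc k) + (1 / \<eta>) *\<^sub>R (w (Suc k) - w k)" for k
      using x_minus_u[of k] by (simp add: algebra_simps)
    then have "u (Suc (Suc k)) - u (Suc k) = (x (Suc (Suc k)) - x (Suc k))
        + ((1 / \<eta>) *\<^sub>R (w (Suc (Suc k)) - w (Suc k)) + (- (1 / \<eta>)) *\<^sub>R (w (Suc k) - w k))"
      by simp
    also have "norm \<dots> \<le> step k + ((1 / \<eta>) * norm (w (Suc (Suc k)) - w (Suc k)) + (1 / \<eta>) * norm (w (Suc k) - w k))"
      using eta_range by (intro norm_triangle_mono) (simp_all add: step_def)
    finally show ?thesis .
  qed
  note u_le = this
  have "summable (\<lambda>k. step k
      + ((1 / \<eta>) * norm (w (Suc (Suc k)) - w (Suc k)) + (1 / \<eta>) * norm (w (Suc k) - w k)))"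
    by (intro summable_add S summable_mult sw iffD2[OF summable_Suc_iff[of "\<lambda>k. norm (w (Suc k) - w k)"]])
  then have "summable (\<lambda>k. norm (u (Suc (Suc k)) - u (Suc k)))"
    by (rule summable_comparison_test'[of _ 0]) (simp only: real_norm_def abs_norm_cancel u_le)
  then show "summable (\<lambda>k. norm (u (Suc k) - u k))"
    by (rule iffD1[OF summable_Suc_iff[of "\<lambda>k. norm (u (Suc k) - u k)"]])
  define c where "c = (\<Sum>k. x (Suc k) - x k)"
  have "(\<lambda>n. \<Sum>k<n. x (Suc k) - x k) \<longlonglongrightarrow> c"
    unfolding c_def by (rule summable_LIMSEQ) (rule summable_norm_cancel[OF sx])
  then have "(\<lambda>n. (x n - x 0) + x 0) \<longlonglongrightarrow> c + x 0"
    unfolding sum_lessThan_telescope by (intro tendsto_intros)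
  then have x: "x \<longlonglongrightarrow> c + x 0" by simp
  then have X: "(\<lambda>k. x (Suc k)) \<longlonglongrightarrow> c + x 0" by (rule LIMSEQ_Suc)
  have "(\<lambda>k. x (Suc k) - u (Suc k)) \<longlonglongrightarrow> 0"
    by (rule Lim_null_comparison[OF always_eventually tendsto_mult_right_zero[OF summable_LIMSEQ_zero[OF S], of "(1 + L) / \<eta>"]])
      (intro allI norm_x_minus_u)
  from tendsto_diff[OF X this] have U: "(\<lambda>k. u (Suc k)) \<longlonglongrightarrow> c + x 0" by simp
  from critical_limit[OF X U] x LIMSEQ_imp_Suc[OF U]
  show "\<exists>a. x \<longlonglongrightarrow> a \<and> u \<longlonglongrightarrow> a \<and>
      0 \<in> limiting_subdiff (\<lambda>p. ereal (\<psi> p) + ereal (1 / \<gamma> * \<phi>1 p) + ereal (1 / \<gamma>) * \<phi>2 p) a"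
    by blast
qed

end

theorem theorem4:
  fixes \<psi> \<phi>1 :: "real ^ 'n \<Rightarrow> real" and \<phi>2 :: "real ^ 'n \<Rightarrow> ereal"
    and \<beta> l L \<gamma> \<eta> :: real
    and x u w :: "nat \<Rightarrow> real ^ 'n"
  assumes psi_diff: "\<forall>p. \<psi> differentiable (at p)"
    and psi_lipschitz: "\<beta>-lipschitz_on UNIV (grad \<psi>)"
    and l_range: "0 \<le> l" "l < 1"
    and phi1_weakly_convex: "weakly_convex l \<phi>1"
    and phi1_diff: "\<forall>p. \<phi>1 differentiable (at p)"
    and phi1_lipschitz: "L-lipschitz_on UNIV (grad \<phi>1)"
    and phi2_proper: "proper_fun \<phi>2"
    and phi2_closed: "closed_fun \<phi>2"
    and phi2_prox: "\<forall>q. prox \<phi>2 q \<noteq> {}"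
    and gamma_pos: "0 < \<gamma>"
    and eta_range: "0 < \<eta>" "\<eta> \<le> 1"
    and Lambda_pos: "0 < Lambda \<beta> l L \<gamma> \<eta>"
    and x_step: "\<forall>k. prox (\<lambda>p. ereal (\<phi>1 p)) (w k) = {x (Suc k)}"
    and u_step: "\<forall>k. u (Suc k) \<in>
      prox \<phi>2 (2 *\<^sub>R x (Suc k) - w k - \<gamma> *\<^sub>R grad \<psi> (x (Suc k)))"
    and w_step: "\<forall>k. w (Suc k) = w k + \<eta> *\<^sub>R (u (Suc k) - x (Suc k))"
    and bdd: "bounded (range (\<lambda>k. (x k, u k, w k)))"
    and KL: "KL_function (Theta \<psi> \<phi>1 \<phi>2 \<gamma> \<eta>)"
  shows "summable (\<lambda>k. norm (x (Suc k) - x k)) \<and>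
         summable (\<lambda>k. norm (u (Suc k) - u k)) \<and>
         summable (\<lambda>k. norm (w (Suc k) - w k)) \<and>
         (\<exists>xstar. x \<longlonglongrightarrow> xstar \<and> u \<longlonglongrightarrow> xstar \<and>
            0 \<in> limiting_subdiff
                  (\<lambda>p. ereal (\<psi> p) + ereal (1 / \<gamma> * \<phi>1 p) + ereal (1 / \<gamma>) * \<phi>2 p) xstar)"
proof -
  interpret dys_iteration \<psi> \<phi>1 \<phi>2 \<beta> l L \<gamma> \<eta> x u w
    by (unfold_locales; fact)
  show ?thesis
    using finite_length_and_critical_limit[OF bdd KL] by blast
qed

end
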